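(* Let $(S^2,g_0)$ be the $2$-sphere with the round metric of sectional curvature $1$. Then there exist a proper s-convex subset $D\subsetneq S^2$ of $(S^2,g_0)$ and a $C^\infty$ Riemannian metric $g$ on $S^2$ such that $g=g_0$ on $S^2\setminus D$, the sectional curvature of $g$ is bounded above by $1$, and $(S^2,g)$ is not isometric to $(S^2,g_0)$.
   Context: A subset $D$ of a Riemannian manifold $(X,g)$ is s-convex if for every pair of points $x,y\in D$, every minimizing geodesic segment of $(X,g)$ from $x$ to $y$ is contained in $D$. *)

theory Defs
  imports "HOL-Analysis.Analysis"
begin

section \<open>Smooth maps\<close>

text \<open>
  Meant for open sets \<open>S\<close> only: \<open>f\<close> is \<open>n\<close> times continuously differentiable on \<open>S\<close> if
  it is differentiable and all its directional derivatives are \<open>n - 1\<close> times continuously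
  differentiable.
\<close>

primrec C_diff_on :: "nat \<Rightarrow> 'a::real_normed_vector set \<Rightarrow> ('a \<Rightarrow> 'b::real_normed_vector) \<Rightarrow> bool"
  where
    "C_diff_on 0 S f \<longleftrightarrow> continuous_on S f"
  | "C_diff_on (Suc n) S f \<longleftrightarrow>
       (\<forall>x\<in>S. f differentiable (at x)) \<and>
       (\<forall>v. C_diff_on n S (\<lambda>x. frechet_derivative f (at x) v))"

definition smooth_on :: "'a::real_normed_vector set \<Rightarrow> ('a \<Rightarrow> 'b::real_normed_vector) \<Rightarrow> bool"
  where "smooth_on S f \<longleftrightarrow> (\<forall>n. C_diff_on n S f)"

definition partial :: "'n::finite \<Rightarrow> (real^'n \<Rightarrow> 'b::real_normed_vector) \<Rightarrow> real^'n \<Rightarrow> 'b"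
  where "partial i f u = frechet_derivative f (at u) (axis i 1)"


section \<open>Riemannian geometry of a metric given by its coefficient matrix\<close>

text \<open>
  \<open>G u $ i $ j\<close> is the metric coefficient $g_{ij}$ at the coordinate point \<open>u\<close>, and
  \<open>christoffel G u k i j\<close> is $\Gamma^k_{ij}$.
\<close>

definition christoffel :: "(real^'n \<Rightarrow> real^'n^'n) \<Rightarrow> real^'n \<Rightarrow> 'n::finite \<Rightarrow> 'n \<Rightarrow> 'n \<Rightarrow> real"
  where
    "christoffel G u k i j =
       (1 / 2) * (\<Sum>l\<in>UNIV. matrix_inv (G u) $ k $ l *
          (partial i (\<lambda>x. G x $ j $ l) u + partial j (\<lambda>x. G x $ i $ l) u
             - partial l (\<lambda>x. G x $ i $ j) u))"

text \<open>
  \<open>riemann G u l i j k\<close> is the coefficient of $\partial_l$ in $R(\partial_i,\partial_j)\partial_k$,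
  where $R(X,Y)Z = \nabla_X\nabla_Y Z - \nabla_Y\nabla_X Z - \nabla_{[X,Y]}Z$.
\<close>

definition riemann ::
    "(real^'n \<Rightarrow> real^'n^'n) \<Rightarrow> real^'n \<Rightarrow> 'n::finite \<Rightarrow> 'n \<Rightarrow> 'n \<Rightarrow> 'n \<Rightarrow> real"
  where
    "riemann G u l i j k =
       partial i (\<lambda>x. christoffel G x l j k) u - partial j (\<lambda>x. christoffel G x l i k) u
       + (\<Sum>m\<in>UNIV. christoffel G u l i m * christoffel G u m j k
                   - christoffel G u l j m * christoffel G u m i k)"

definition coord_inner :: "(real^'n \<Rightarrow> real^'n^'n) \<Rightarrow> real^'n \<Rightarrow> real^'n \<Rightarrow> real^'n::finite \<Rightarrow> real"
  where "coord_inner G u v w = v \<bullet> (G u *v w)"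

text \<open>
  $\langle R(v,w)w,v\rangle / (|v|^2|w|^2 - \langle v,w\rangle^2)$, the sectional curvature of the
  plane spanned by \<open>v\<close> and \<open>w\<close>; meaningful for linearly independent \<open>v\<close>, \<open>w\<close> only.
\<close>

definition sectional_curvature ::
    "(real^'n \<Rightarrow> real^'n^'n) \<Rightarrow> real^'n \<Rightarrow> real^'n \<Rightarrow> real^'n::finite \<Rightarrow> real"
  where
    "sectional_curvature G u v w =
       coord_inner G u
         (\<chi> l. \<Sum>i\<in>UNIV. \<Sum>j\<in>UNIV. \<Sum>k\<in>UNIV. riemann G u l i j k * v $ i * w $ j * w $ k) v
       / (coord_inner G u v v * coord_inner G u w w - (coord_inner G u v w)\<^sup>2)"


section \<open>The smooth 2-sphere\<close>

abbreviation S2 :: "(real^3) set"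
  where "S2 \<equiv> sphere 0 1"

definition tangent_space :: "real^3 \<Rightarrow> (real^3) set"
  where "tangent_space p = {v. p \<bullet> v = 0}"

text \<open>
  For \<open>s = 1\<close> and \<open>s = -1\<close>: the inverse of stereographic projection from the pole \<open>(0, 0, s)\<close>,
  an injective parametrization of the sphere without that pole.  The two parametrizations
  form an atlas of the standard smooth structure.
\<close>

definition stereo :: "real \<Rightarrow> real^2 \<Rightarrow> real^3"
  where
    "stereo s u = (1 / ((norm u)\<^sup>2 + 1)) *\<^sub>R vector [2 * u $ 1, 2 * u $ 2, s * ((norm u)\<^sup>2 - 1)]"

definition atlas :: "(real^2 \<Rightarrow> real^3) set"
  where "atlas = {stereo 1, stereo (-1)}"


section \<open>Riemannian metrics on the 2-sphere\<close>

text \<open>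
  A metric assigns to each point \<open>p\<close> of the sphere a bilinear form; only its values on
  \<open>tangent_space p\<close> matter.
\<close>

type_synonym metric = "real^3 \<Rightarrow> real^3 \<Rightarrow> real^3 \<Rightarrow> real"

text \<open>The coefficient matrix of the pullback of \<open>g\<close> along \<open>\<psi>\<close>.\<close>

definition metric_coeffs :: "metric \<Rightarrow> (real^2 \<Rightarrow> real^3) \<Rightarrow> real^2 \<Rightarrow> real^2^2"
  where "metric_coeffs g \<psi> u = (\<chi> i j. g (\<psi> u) (partial i \<psi> u) (partial j \<psi> u))"

definition riemannian_metric :: "metric \<Rightarrow> bool"
  where
    "riemannian_metric g \<longleftrightarrow>
       (\<forall>p\<in>S2. \<forall>v\<in>tangent_space p.
          (\<forall>w\<in>tangent_space p. g p v w = g p w v) \<and>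
          (\<forall>w\<in>tangent_space p. \<forall>w'\<in>tangent_space p. g p v (w + w') = g p v w + g p v w') \<and>
          (\<forall>w\<in>tangent_space p. \<forall>c. g p v (c *\<^sub>R w) = c * g p v w) \<and>
          (v \<noteq> 0 \<longrightarrow> g p v v > 0)) \<and>
       (\<forall>\<phi>\<in>atlas. \<forall>i j. smooth_on UNIV (\<lambda>u. metric_coeffs g \<phi> u $ i $ j))"

text \<open>The metric induced by the Euclidean metric on the unit sphere.\<close>

definition round_metric :: metric
  where "round_metric p v w = v \<bullet> w"

definition metrics_agree_on :: "(real^3) set \<Rightarrow> metric \<Rightarrow> metric \<Rightarrow> bool"
  where
    "metrics_agree_on A g h \<longleftrightarrow>
       (\<forall>p\<in>A. \<forall>v\<in>tangent_space p. \<forall>w\<in>tangent_space p. g p v w = h p v w)"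

definition sectional_curvature_le :: "metric \<Rightarrow> real \<Rightarrow> bool"
  where
    "sectional_curvature_le g c \<longleftrightarrow>
       (\<forall>\<phi>\<in>atlas. \<forall>u v w. v \<noteq> w \<and> independent {v, w} \<longrightarrow>
          sectional_curvature (metric_coeffs g \<phi>) u v w \<le> c)"

text \<open>
  A diffeomorphism of the sphere with \<open>f\<close> pulling \<open>h\<close> back to \<open>g\<close>; smoothness of maps into the
  sphere is smoothness as maps into the ambient space.
\<close>

definition isometry :: "metric \<Rightarrow> metric \<Rightarrow> (real^3 \<Rightarrow> real^3) \<Rightarrow> bool"
  where
    "isometry g h f \<longleftrightarrow>
       bij_betw f S2 S2 \<and>
       (\<forall>\<phi>\<in>atlas. smooth_on UNIV (f \<circ> \<phi>)) \<and>
       (\<forall>\<phi>\<in>atlas. smooth_on UNIV (inv_into S2 f \<circ> \<phi>)) \<and>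
       (\<forall>\<phi>\<in>atlas. \<forall>u. metric_coeffs h (f \<circ> \<phi>) u = metric_coeffs g \<phi> u)"

definition isometric :: "metric \<Rightarrow> metric \<Rightarrow> bool"
  where "isometric g h \<longleftrightarrow> (\<exists>f. isometry g h f)"


section \<open>Minimizing geodesics and s-convexity\<close>

definition speed :: "metric \<Rightarrow> (real \<Rightarrow> real^3) \<Rightarrow> real \<Rightarrow> real"
  where
    "speed g \<gamma> t = sqrt (g (\<gamma> t) (vector_derivative \<gamma> (at t)) (vector_derivative \<gamma> (at t)))"

definition riem_length :: "metric \<Rightarrow> (real \<Rightarrow> real^3) \<Rightarrow> real"
  where "riem_length g \<gamma> = integral {0..1} (speed g \<gamma>)"

text \<open>
  The predicate \<open>valid_path\<close> allows the derivative to be unbounded near the finitely many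
  break points, so integrability of the speed (finite length) has to be required separately:
  the integral of a non-integrable function is 0 by convention.
\<close>

definition riem_dist :: "metric \<Rightarrow> real^3 \<Rightarrow> real^3 \<Rightarrow> real"
  where
    "riem_dist g x y =
       Inf {riem_length g \<gamma> | \<gamma>. valid_path \<gamma> \<and> path_image \<gamma> \<subseteq> S2 \<and>
              pathstart \<gamma> = x \<and> pathfinish \<gamma> = y \<and> speed g \<gamma> integrable_on {0..1}}"

text \<open>
  Geodesics are smooth solutions of the geodesic equation
  $\ddot c^k + \Gamma^k_{ij}\dot c^i\dot c^j = 0$ for their local coordinate expressions \<open>c\<close>.
  A segment is parametrized on \<open>{0..1}\<close>; asking for the equation on an open interval around it
  gives the derivatives at the end points their usual meaning.
\<close>

definition geodesic_on :: "metric \<Rightarrow> real set \<Rightarrow> (real \<Rightarrow> real^3) \<Rightarrow> bool"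
  where
    "geodesic_on g I \<gamma> \<longleftrightarrow>
       smooth_on I \<gamma> \<and> \<gamma> ` I \<subseteq> S2 \<and>
       (\<forall>\<phi>\<in>atlas. \<forall>t\<in>I. \<gamma> t \<in> range \<phi> \<longrightarrow>
          (let c = inv \<phi> \<circ> \<gamma>;
               c' = (\<lambda>s. vector_derivative c (at s));
               c'' = vector_derivative c' (at t)
           in \<forall>k. c'' $ k + (\<Sum>i\<in>UNIV. \<Sum>j\<in>UNIV.
                    christoffel (metric_coeffs g \<phi>) (c t) k i j * c' t $ i * c' t $ j) = 0))"

definition geodesic_segment :: "metric \<Rightarrow> (real \<Rightarrow> real^3) \<Rightarrow> bool"
  where
    "geodesic_segment g \<gamma> \<longleftrightarrow> (\<exists>a b. a < 0 \<and> 1 < b \<and> geodesic_on g {a<..<b} \<gamma>)"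

definition minimizing_geodesic_segment ::
    "metric \<Rightarrow> real^3 \<Rightarrow> real^3 \<Rightarrow> (real \<Rightarrow> real^3) \<Rightarrow> bool"
  where
    "minimizing_geodesic_segment g x y \<gamma> \<longleftrightarrow>
       geodesic_segment g \<gamma> \<and> pathstart \<gamma> = x \<and> pathfinish \<gamma> = y \<and>
       riem_length g \<gamma> = riem_dist g x y"

definition s_convex :: "metric \<Rightarrow> (real^3) set \<Rightarrow> bool"
  where
    "s_convex g D \<longleftrightarrow>
       D \<subseteq> S2 \<and>
       (\<forall>x\<in>D. \<forall>y\<in>D. \<forall>\<gamma>. minimizing_geodesic_segment g x y \<gamma> \<longrightarrow> path_image \<gamma> \<subseteq> D)"

end

theory Submission
  imports Defs
begin

text \<open>
  The metric is conformal to the round one, \<open>g = exp (2 * \<Phi>) * g\<^sub>0\<close>, with a factor \<open>\<Phi>\<close> that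
  depends only on the height \<open>z\<close>, vanishes for \<open>z \<ge> 0\<close> and is enormous near the south pole.  So
  the southern hemisphere is replaced by a huge balloon, attached to the northern one along a
  neck.  The set \<open>D\<close> is the open southern hemisphere.

  Rigidity fails because an upper curvature bound does not prevent the metric from being large.
  For a conformal metric the condition \<open>K \<le> 1\<close> reads
  \<open>1 - ((1 - z\<^sup>2) * \<Phi>'' - 2 * z * \<Phi>') \<le> exp (2 * \<Phi>)\<close>: the left-hand side is \<open>1\<close> minus the
  round Laplacian of \<open>\<Phi>\<close>.  For \<open>\<Phi> = C * exp (1 / z)\<close> on \<open>z < 0\<close> it can be met for two different
  reasons.  Near the equator \<open>\<Phi>\<close> is so convex in \<open>z\<close> that the Laplacian is nonnegative (this is
  the neck, where the curvature becomes very negative); away from the equator \<open>exp (2 * \<Phi>)\<close> exceeds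
  everything else once \<open>C\<close> is large.  For small \<open>C\<close> the inequality fails, for instance at
  \<open>z = - (1 / 2)\<close>.  The estimate is \<open>bump_curvature\<close>, the curvature formula is
  \<open>sectional_curvature_le_conformal\<close>, and smoothness across the equator is that of the flat
  function \<open>exp (- (1 / s))\<close>.

  The round geometry enters in two ways.  A path of length at most the angle between its end
  points has every one of its points between these end points, in the sense of equality in the
  spherical triangle inequality; linear algebra then keeps it in any open hemisphere containing
  both (\<open>between_points_of_hemisphere\<close>).

  The two metrics are told apart by a diameter argument.  Any two points of the round sphere are
  joined by a great circle arc of length at most \<open>pi\<close>, and the inverse of an isometry carries
  the arc between the images of the poles to a curve between the poles of \<open>g\<close>-length at most
  \<open>pi\<close>.  But a suitable function of the height has \<open>g\<close>-gradient at most \<open>1\<close> and takes values at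
  the poles that differ by more than \<open>pi\<close> (\<open>not_isometric_of_distant_poles\<close>).
\<close>


section \<open>Smooth functions\<close>

lemma has_derivative_imp_frechet_derivative:
  "(f has_derivative f') (at x) \<Longrightarrow> frechet_derivative f (at x) = f'"
  using frechet_derivative_at by metis

lemma differentiable_frechet_derivative:
  "f differentiable (at x) \<Longrightarrow> (f has_derivative frechet_derivative f (at x)) (at x)"
  by (simp add: frechet_derivative_works)

lemma C_diff_on_SucI:
  assumes "\<And>x. (f has_derivative f' x) (at x)" "\<And>v. C_diff_on n UNIV (\<lambda>x. f' x v)"
  shows "C_diff_on (Suc n) UNIV f"
  using assms by (auto simp: differentiable_def has_derivative_imp_frechet_derivative[OF assms(1)])

text \<open>
  \<open>C_diff_on\<close> passes to all directional derivatives at once, so even the loss of one order has to be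
  proved by induction over all functions simultaneously.
\<close>

lemma C_diff_on_Suc_imp:
  "C_diff_on (Suc n) S f \<Longrightarrow> C_diff_on n S f"
proof (induction n arbitrary: f)
  case 0
  then show ?case
    by (auto intro!: continuous_at_imp_continuous_on differentiable_imp_continuous_within)
next
  case (Suc n)
  then show ?case by (metis C_diff_on.simps(2))
qed

lemma C_diff_on_const: "C_diff_on n UNIV (\<lambda>_. c)"
  by (induction n arbitrary: c) auto

lemma C_diff_on_bounded_linear:
  assumes "bounded_linear f"
  shows "C_diff_on n UNIV f"
proof (cases n)
  case 0
  then show ?thesis using assms by (simp add: linear_continuous_on)
next
  case (Suc m)
  have "(f has_derivative f) (at x)" for x
    using assms by (simp add: bounded_linear_imp_has_derivative)
  then show ?thesis
    unfolding Suc by (rule C_diff_on_SucI) (simp add: C_diff_on_const)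
qed

lemma C_diff_on_add:
  assumes "C_diff_on n UNIV f" "C_diff_on n UNIV g"
  shows "C_diff_on n UNIV (\<lambda>x. f x + g x)"
  using assms
proof (induction n arbitrary: f g)
  case 0
  then show ?case by (simp add: continuous_on_add)
next
  case (Suc n)
  show ?case
  proof (rule C_diff_on_SucI)
    show "((\<lambda>x. f x + g x) has_derivative
        (\<lambda>v. frechet_derivative f (at x) v + frechet_derivative g (at x) v)) (at x)" for x
      using Suc.prems by (intro has_derivative_add differentiable_frechet_derivative) auto
    show "C_diff_on n UNIV (\<lambda>x. frechet_derivative f (at x) v + frechet_derivative g (at x) v)" for v
      using Suc by simp
  qed
qed

lemma C_diff_on_mult:
  fixes f g :: "'a::real_normed_vector \<Rightarrow> real"
  assumes "C_diff_on n UNIV f" "C_diff_on n UNIV g"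
  shows "C_diff_on n UNIV (\<lambda>x. f x * g x)"
  using assms
proof (induction n arbitrary: f g)
  case 0
  then show ?case by (simp add: continuous_on_mult)
next
  case (Suc n)
  show ?case
  proof (rule C_diff_on_SucI)
    show "((\<lambda>x. f x * g x) has_derivative
        (\<lambda>v. f x * frechet_derivative g (at x) v + frechet_derivative f (at x) v * g x)) (at x)" for x
      using Suc.prems by (intro has_derivative_mult differentiable_frechet_derivative) auto
    show "C_diff_on n UNIV (\<lambda>x. f x * frechet_derivative g (at x) v + frechet_derivative f (at x) v * g x)" for v
      using Suc.IH Suc.prems C_diff_on_Suc_imp[OF Suc.prems(1)] C_diff_on_Suc_imp[OF Suc.prems(2)]
      by (intro C_diff_on_add Suc.IH) auto
  qed
qed

text \<open>
  A chain rule for outer functions that come in a family \<open>F\<close> closed under differentiation, \<open>d\<close> sending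
  the index of a function to that of its derivative.  The derivative of \<open>F i \<circ> g\<close> is a product of
  \<open>F (d i) \<circ> g\<close> with a derivative of \<open>g\<close>, so quantifying over the indices makes the induction on the
  order of differentiability go through without any higher-order chain rule.  The exponential
  function, powers of \<open>inverse\<close> and the flat functions below are such families.
\<close>

lemma C_diff_on_compose_family:
  fixes F :: "'i \<Rightarrow> real \<Rightarrow> real" and g :: "'a::real_normed_vector \<Rightarrow> real"
  assumes deriv: "\<And>i x. x \<in> T \<Longrightarrow> (F i has_real_derivative F (d i) x) (at x)"
    and range: "\<And>u. g u \<in> T" and "C_diff_on n UNIV g"
  shows "C_diff_on n UNIV (\<lambda>u. F i (g u))"
  using assms(3)
proof (induction n arbitrary: i)
  case 0
  have "isCont (F i) (g u)" for u
    using deriv range by (blast intro: DERIV_isCont)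
  then show ?case
    using 0 by (auto simp: continuous_on_eq_continuous_within intro: isCont_o2)
next
  case (Suc n)
  show ?case
  proof (rule C_diff_on_SucI)
    fix u
    have "(g has_derivative frechet_derivative g (at u)) (at u)"
      using Suc.prems by (intro differentiable_frechet_derivative) auto
    from has_derivative_compose[OF this has_field_derivative_imp_has_derivative[OF deriv[OF range]]]
    show "((\<lambda>u. F i (g u)) has_derivative (\<lambda>v. F (d i) (g u) * frechet_derivative g (at u) v)) (at u)" .
  next
    fix v
    show "C_diff_on n UNIV (\<lambda>u. F (d i) (g u) * frechet_derivative g (at u) v)"
      using Suc.IH[OF C_diff_on_Suc_imp[OF Suc.prems]] Suc.prems by (intro C_diff_on_mult) auto
  qed
qed

lemma smooth_on_const: "smooth_on UNIV (\<lambda>_. c)"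
  by (simp add: smooth_on_def C_diff_on_const)

lemma smooth_on_bounded_linear: "bounded_linear f \<Longrightarrow> smooth_on UNIV f"
  by (simp add: smooth_on_def C_diff_on_bounded_linear)

lemma smooth_on_add:
  "smooth_on UNIV f \<Longrightarrow> smooth_on UNIV g \<Longrightarrow> smooth_on UNIV (\<lambda>x. f x + g x)"
  by (simp add: smooth_on_def C_diff_on_add)

lemma smooth_on_mult:
  fixes f g :: "'a::real_normed_vector \<Rightarrow> real"
  shows "smooth_on UNIV f \<Longrightarrow> smooth_on UNIV g \<Longrightarrow> smooth_on UNIV (\<lambda>x. f x * g x)"
  by (simp add: smooth_on_def C_diff_on_mult)

lemma smooth_on_exp: "smooth_on UNIV f \<Longrightarrow> smooth_on UNIV (\<lambda>x. exp (f x :: real))"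
  unfolding smooth_on_def
  by (intro allI C_diff_on_compose_family[where F = "\<lambda>_. exp" and T = UNIV]) auto

lemma smooth_on_inverse:
  fixes f :: "'a::real_normed_vector \<Rightarrow> real"
  assumes "smooth_on UNIV f" "\<And>x. f x \<noteq> 0"
  shows "smooth_on UNIV (\<lambda>x. inverse (f x))"
proof -
  \<comment> \<open>Indexed by \<open>(c, k)\<close>, a family that contains \<open>inverse\<close> and is closed under differentiation away from \<open>0\<close>.\<close>
  define F :: "real \<times> nat \<Rightarrow> real \<Rightarrow> real" where "F = (\<lambda>(c, k) x. c * inverse x ^ Suc k)"
  define d :: "real \<times> nat \<Rightarrow> real \<times> nat" where "d = (\<lambda>(c, k). (- (c * real (Suc k)), Suc k))"
  have deriv: "(F i has_real_derivative F (d i) x) (at x)" if "x \<in> - {0}" for i x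
  proof -
    obtain c k where i: "i = (c, k)" by (cases i)
    have "x \<noteq> 0" using that by simp
    have "((\<lambda>x. c * inverse x ^ Suc k) has_real_derivative
        - (c * real (Suc k)) * inverse x ^ Suc (Suc k)) (at x)"
      by (rule DERIV_cong[OF DERIV_cmult[OF DERIV_power[OF DERIV_inverse[OF \<open>x \<noteq> 0\<close>]]]])
         (simp only: power_Suc diff_Suc_Suc diff_zero power_0 mult_1_right mult_minus_left mult_minus_right mult.assoc)
    then show ?thesis by (simp only: i F_def d_def prod.case)
  qed
  have "C_diff_on n UNIV (\<lambda>x. F (1, 0) (f x))" for n
    by (rule C_diff_on_compose_family[where F = F and d = d and T = "- {0}", OF deriv])
       (use assms in \<open>auto simp: smooth_on_def\<close>)
  then show ?thesis by (simp add: F_def smooth_on_def)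
qed

lemma smooth_on_has_derivative:
  assumes "smooth_on UNIV f"
  shows "(f has_derivative frechet_derivative f (at x)) (at x)"
proof -
  have "C_diff_on (Suc 0) UNIV f" using assms by (simp only: smooth_on_def)
  then show ?thesis by (intro differentiable_frechet_derivative) simp
qed


section \<open>A flat function\<close>

text \<open>
  The polynomial factor in \<open>1 / s\<close> makes the family closed under differentiation; for \<open>p = 1\<close> this is the
  standard smooth function that is positive exactly for \<open>s > 0\<close>.
\<close>

definition flat_exp :: "real poly \<Rightarrow> real \<Rightarrow> real"
  where "flat_exp p s = (if s > 0 then poly p (1 / s) * exp (- (1 / s)) else 0)"

text \<open>
  With \<open>x = 1 / s\<close> the derivative of \<open>p x * exp (- x)\<close> with respect to \<open>s\<close> is
  \<open>x\<^sup>2 * (p x - p' x) * exp (- x)\<close>.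
\<close>

definition flat_exp_deriv_poly :: "real poly \<Rightarrow> real poly"
  where "flat_exp_deriv_poly p = [:0, 0, 1:] * (p - pderiv p)"

lemma poly_times_exp_minus_tendsto_0:
  "((\<lambda>x::real. poly p x * exp (- x)) \<longlongrightarrow> 0) at_top"
proof -
  have "((\<lambda>x. \<Sum>i\<le>degree p. coeff p i * (x ^ i / exp x)) \<longlongrightarrow> (\<Sum>i\<le>degree p. coeff p i * 0)) at_top"
    by (intro tendsto_intros tendsto_power_div_exp_0)
  then show ?thesis
    by (simp add: poly_altdef sum_distrib_right exp_minus divide_inverse mult.assoc)
qed

lemma flat_exp_tendsto_0: "(flat_exp p \<longlongrightarrow> 0) (at 0)"
proof -
  have "((\<lambda>s. poly p (inverse s) * exp (- inverse s)) \<longlongrightarrow> 0) (at_right 0)"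
    by (rule filterlim_compose[OF poly_times_exp_minus_tendsto_0 filterlim_inverse_at_top_right])
  moreover have "\<forall>\<^sub>F s in at_right 0. poly p (inverse s) * exp (- inverse s) = flat_exp p s"
    by (simp add: eventually_at_filter flat_exp_def inverse_eq_divide)
  ultimately have "(flat_exp p \<longlongrightarrow> 0) (at_right 0)"
    using tendsto_cong by fastforce
  moreover have "(flat_exp p \<longlongrightarrow> 0) (at_left 0)"
  proof (rule tendsto_eventually)
    show "\<forall>\<^sub>F s in at_left 0. flat_exp p s = 0"
      by (simp add: eventually_at_filter flat_exp_def)
  qed
  ultimately show ?thesis
    by (simp add: filterlim_at_split)
qed

text \<open>
  At \<open>0\<close> the difference quotient of a flat function is the flat function with \<open>p\<close> multiplied by \<open>1 / s\<close>,
  and exponential decay beats every polynomial.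
\<close>

lemma flat_exp_has_derivative:
  "(flat_exp p has_real_derivative flat_exp (flat_exp_deriv_poly p) s) (at s)"
proof -
  consider "s < 0" | "s = 0" | "s > 0" by linarith
  then show ?thesis
  proof cases
    case 1
    have "(flat_exp p has_real_derivative 0) (at s)"
      by (rule has_field_derivative_transform_within_open[where S = "{..<0}" and f = "\<lambda>_. 0"])
         (use 1 in \<open>auto simp: flat_exp_def\<close>)
    with 1 show ?thesis by (simp add: flat_exp_def)
  next
    case 2
    have "(\<lambda>h. (flat_exp p (0 + h) - flat_exp p 0) / h) = flat_exp ([:0, 1:] * p)"
      by (auto simp: flat_exp_def fun_eq_iff)
    then have "(flat_exp p has_real_derivative 0) (at 0)"
      unfolding DERIV_def using flat_exp_tendsto_0 by metis
    with 2 show ?thesis by (simp add: flat_exp_def)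
  next
    case 3
    have "((\<lambda>s. poly p (1 / s) * exp (- (1 / s))) has_real_derivative
        flat_exp (flat_exp_deriv_poly p) s) (at s)"
    proof -
      have inv: "((\<lambda>s. 1 / s) has_real_derivative - (1 / s)\<^sup>2) (at s)"
        using 3 by (auto intro!: derivative_eq_intros simp: power2_eq_square)
      have "((\<lambda>s. poly p (1 / s)) has_real_derivative poly (pderiv p) (1 / s) * - (1 / s)\<^sup>2) (at s)"
        by (rule DERIV_chain2[OF poly_DERIV inv])
      then show ?thesis
        using 3 by (auto intro!: derivative_eq_intros inv simp: flat_exp_def flat_exp_deriv_poly_def
            power2_eq_square algebra_simps)
    qed
    then show ?thesis
      by (rule has_field_derivative_transform_within_open[where S = "{0<..}"])
         (use 3 in \<open>auto simp: flat_exp_def\<close>)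
  qed
qed

lemma smooth_on_flat_exp: "smooth_on UNIV f \<Longrightarrow> smooth_on UNIV (\<lambda>x. flat_exp p (f x))"
  unfolding smooth_on_def
  by (intro allI C_diff_on_compose_family[where F = flat_exp and d = flat_exp_deriv_poly and T = UNIV])
     (auto simp: flat_exp_has_derivative)


section \<open>Curvature of conformally flat metrics\<close>

lemma partial_eq: "(f has_derivative f') (at u) \<Longrightarrow> partial i f u = f' (axis i 1)"
  by (simp add: partial_def has_derivative_imp_frechet_derivative)

definition scalar_matrix :: "real \<Rightarrow> real^'n^'n"
  where "scalar_matrix c = (\<chi> i j. if i = j then c else 0)"

lemma scalar_matrix_nth: "scalar_matrix c $ i $ j = (if i = j then c else 0)"
  by (simp add: scalar_matrix_def)

lemma scalar_matrix_mult: "scalar_matrix c ** scalar_matrix d = scalar_matrix (c * d)"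
  by (simp add: matrix_matrix_mult_def scalar_matrix_def vec_eq_iff if_distrib[where f = "\<lambda>x. _ * x"]
      if_distrib[where f = "\<lambda>x. x * _"] cong: if_cong)

lemma matrix_inv_scalar_matrix:
  assumes "c \<noteq> 0"
  shows "matrix_inv (scalar_matrix c :: real^'n^'n) = scalar_matrix (1 / c)"
proof -
  have inv: "scalar_matrix c ** scalar_matrix (1 / c) = (mat 1 :: real^'n^'n)"
       "scalar_matrix (1 / c) ** scalar_matrix c = (mat 1 :: real^'n^'n)"
    using assms by (simp_all add: scalar_matrix_mult) (simp_all add: scalar_matrix_def mat_def)
  then have "invertible (scalar_matrix c :: real^'n^'n)"
    unfolding invertible_def by blast
  then have "matrix_inv (scalar_matrix c) ** scalar_matrix c = (mat 1 :: real^'n^'n)"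
    unfolding matrix_inv_def invertible_def by (rule someI2_ex) auto
  then show ?thesis
    by (metis inv(1) matrix_mul_assoc matrix_mul_lid matrix_mul_rid)
qed

lemma coord_inner_scalar_matrix:
  "G u = scalar_matrix c \<Longrightarrow> coord_inner G u v w = c * (v \<bullet> w)"
  by (simp add: coord_inner_def scalar_matrix_def matrix_vector_mult_def inner_vec_def
      sum_distrib_left algebra_simps if_distrib[where f = "\<lambda>x. _ * x"]
      if_distrib[where f = "\<lambda>x. x * _"] cong: if_cong)

text \<open>
  For the metric \<open>exp (2 * w)\<close> times the Euclidean one the exponential cancels between the metric and its
  inverse, and the Christoffel symbols are linear in the gradient \<open>dw\<close> of \<open>w\<close>.  Parametrizing by \<open>w\<close>
  rather than by the conformal factor itself is what keeps the curvature computation polynomial.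
\<close>

lemma christoffel_conformal:
  fixes w :: "real^'n \<Rightarrow> real" and dw :: "real^'n \<Rightarrow> real^'n"
  assumes G: "\<And>x. G x = scalar_matrix (exp (2 * w x))"
    and dw: "\<And>x. (w has_derivative (\<lambda>v. dw x \<bullet> v)) (at x)"
  shows "christoffel G x k i j =
    of_bool (j = k) * dw x $ i + of_bool (i = k) * dw x $ j - of_bool (i = j) * dw x $ k"
proof -
  have dG: "partial m (\<lambda>x. G x $ i $ j) x = 2 * of_bool (i = j) * exp (2 * w x) * dw x $ m" for m i j
  proof -
    have "((\<lambda>x. G x $ i $ j) has_derivative
        (\<lambda>v. of_bool (i = j) * (exp (2 * w x) * (2 * (dw x \<bullet> v))))) (at x)"
      unfolding G scalar_matrix_nth
      by (auto intro!: derivative_eq_intros dw)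
    from partial_eq[OF this] show ?thesis by (simp add: inner_axis)
  qed
  let ?e = "exp (2 * w x)"
  let ?S = "\<lambda>l. 2 * of_bool (j = l) * ?e * dw x $ i + 2 * of_bool (i = l) * ?e * dw x $ j
        - 2 * of_bool (i = j) * ?e * dw x $ l"
  have "christoffel G x k i j = 1 / 2 * (\<Sum>l\<in>UNIV. scalar_matrix (1 / ?e) $ k $ l * ?S l)"
    unfolding christoffel_def dG unfolding G
    by (simp only: matrix_inv_scalar_matrix exp_not_eq_zero not_False_eq_True)
  also have "(\<Sum>l\<in>UNIV. scalar_matrix (1 / ?e) $ k $ l * ?S l) = (\<Sum>l\<in>UNIV. if k = l then 1 / ?e * ?S l else 0)"
    by (intro sum.cong refl) (auto simp only: scalar_matrix_nth if_True if_False mult_zero_left split: if_split)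
  also have "\<dots> = 1 / ?e * ?S k"
    by (simp only: sum.delta' finite UNIV_I if_True)
  also have "1 / 2 * (1 / ?e * ?S k) =
      of_bool (j = k) * dw x $ i + of_bool (i = k) * dw x $ j - of_bool (i = j) * dw x $ k"
    by (simp add: right_diff_distrib distrib_left)
  finally show ?thesis .
qed

lemma riemann_conformal:
  fixes w :: "real^'n \<Rightarrow> real" and dw :: "real^'n \<Rightarrow> real^'n"
  assumes G: "\<And>x. G x = scalar_matrix (exp (2 * w x))"
    and dw: "\<And>x. (w has_derivative (\<lambda>v. dw x \<bullet> v)) (at x)"
    and hess: "\<And>i. ((\<lambda>x. dw x $ i) has_derivative (\<lambda>v. H $ i \<bullet> v)) (at u)"
    and H_sym: "\<And>i j. H $ i $ j = H $ j $ i"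
  shows "riemann G u l i j k =
     of_bool (j = l) * H $ k $ i - of_bool (j = k) * H $ l $ i
     - of_bool (i = l) * H $ k $ j + of_bool (i = k) * H $ l $ j
     + (\<Sum>m\<in>UNIV. (of_bool (m = l) * dw u $ i + of_bool (i = l) * dw u $ m - of_bool (i = m) * dw u $ l)
         * (of_bool (k = m) * dw u $ j + of_bool (j = m) * dw u $ k - of_bool (j = k) * dw u $ m)
       - (of_bool (m = l) * dw u $ j + of_bool (j = l) * dw u $ m - of_bool (j = m) * dw u $ l)
         * (of_bool (k = m) * dw u $ i + of_bool (i = m) * dw u $ k - of_bool (i = k) * dw u $ m))"
proof -
  have dchr: "partial m (\<lambda>x. christoffel G x k i j) u =
     of_bool (j = k) * H $ i $ m + of_bool (i = k) * H $ j $ m - of_bool (i = j) * H $ k $ m" for m k i j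
  proof -
    have "((\<lambda>x. christoffel G x k i j) has_derivative
        (\<lambda>v. of_bool (j = k) * (H $ i \<bullet> v) + of_bool (i = k) * (H $ j \<bullet> v) - of_bool (i = j) * (H $ k \<bullet> v))) (at u)"
      unfolding christoffel_conformal[OF G dw]
      by (intro has_derivative_add has_derivative_diff has_derivative_mult_right hess)
    from partial_eq[OF this] show ?thesis by (simp add: inner_axis)
  qed
  show ?thesis
    unfolding riemann_def dchr unfolding christoffel_conformal[OF G dw]
    by (simp add: H_sym[of j i] algebra_simps)
qed

text \<open>
  The Gauss curvature of a conformally flat surface, \<open>- \<Delta> w / exp (2 * w)\<close>.  In dimension two the terms
  quadratic in the gradient cancel and only the trace of the Hessian \<open>H\<close> survives.
\<close>

lemma sectional_curvature_conformal:
  fixes w :: "real^2 \<Rightarrow> real" and dw :: "real^2 \<Rightarrow> real^2"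
  assumes G: "\<And>x. G x = scalar_matrix (exp (2 * w x))"
    and dw: "\<And>x. (w has_derivative (\<lambda>v. dw x \<bullet> v)) (at x)"
    and hess: "\<And>i. ((\<lambda>x. dw x $ i) has_derivative (\<lambda>v. H $ i \<bullet> v)) (at u)"
    and H_sym: "\<And>i j. H $ i $ j = H $ j $ i"
    and indep: "a $ 1 * b $ 2 \<noteq> a $ 2 * b $ 1"
  shows "sectional_curvature G u a b = - (H $ 1 $ 1 + H $ 2 $ 2) / exp (2 * w u)"
proof -
  \<comment> \<open>Two indices leave sixteen components, each of which is evaluated separately.\<close>
  have curv: "\<forall>l i j k. riemann G u l i j k =
      - (H $ 1 $ 1 + H $ 2 $ 2) * (of_bool (i = l) * of_bool (j = k) - of_bool (j = l) * of_bool (i = k))"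
    unfolding riemann_conformal[OF G dw hess H_sym] forall_2 sum_2
    by (simp add: H_sym[of 2 1])
  have numerator: "(\<chi> l. \<Sum>i\<in>UNIV. \<Sum>j\<in>UNIV. \<Sum>k\<in>UNIV. riemann G u l i j k * a $ i * b $ j * b $ k) \<bullet> a
     = - (H $ 1 $ 1 + H $ 2 $ 2) * (a $ 1 * b $ 2 - a $ 2 * b $ 1)\<^sup>2"
    unfolding curv[rule_format]
    by (simp add: inner_vec_def sum_2) (simp add: power2_eq_square algebra_simps)
  \<comment> \<open>Lagrange's identity in the plane.\<close>
  have denominator: "(c * (a \<bullet> a)) * (c * (b \<bullet> b)) - (c * (a \<bullet> b))\<^sup>2 = c\<^sup>2 * (a $ 1 * b $ 2 - a $ 2 * b $ 1)\<^sup>2" for c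
    by (simp add: inner_vec_def sum_2 power2_eq_square algebra_simps)
  have cancel: "e * (K * d) / (e\<^sup>2 * d) = K / e" if "e \<noteq> 0" "d \<noteq> 0" for e K d :: real
    using that by (simp add: power2_eq_square)
  show ?thesis
    unfolding sectional_curvature_def coord_inner_scalar_matrix[OF G] numerator denominator
    using indep cancel[of "exp (2 * w u)" "(a $ 1 * b $ 2 - a $ 2 * b $ 1)\<^sup>2"] by simp
qed


section \<open>Stereographic charts\<close>

text \<open>
  The equatorial plane in space; it lets the charts and their derivatives be written without coordinates.
\<close>

definition plane_emb :: "real^2 \<Rightarrow> real^3"
  where "plane_emb u = u $ 1 *\<^sub>R axis 1 1 + u $ 2 *\<^sub>R axis 2 1"

definition stereo_deriv :: "real \<Rightarrow> real^2 \<Rightarrow> real^2 \<Rightarrow> real^3"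
  where
    "stereo_deriv s u v = (2 / (u \<bullet> u + 1)) *\<^sub>R plane_emb v
       - (4 * (u \<bullet> v) / (u \<bullet> u + 1)\<^sup>2) *\<^sub>R (plane_emb u - s *\<^sub>R axis 3 1)"

lemma norm2_plus_1_pos: "u \<bullet> u + 1 > (0::real)"
  using inner_ge_zero[of u] by linarith

lemma stereo_eq:
  "stereo s u = (2 / (u \<bullet> u + 1)) *\<^sub>R plane_emb u + (s * (1 - 2 / (u \<bullet> u + 1))) *\<^sub>R axis 3 1"
proof -
  define n where "n = u \<bullet> u + 1"
  have n: "n \<noteq> 0" "u \<bullet> u = n - 1"
    using norm2_plus_1_pos[of u] by (simp_all add: n_def)
  show ?thesis
    using n(1) by (simp add: stereo_def plane_emb_def vec_eq_iff forall_3 axis_def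
        power2_norm_eq_inner n(2) field_simps)
qed

lemma bounded_linear_plane_emb: "bounded_linear plane_emb"
  unfolding plane_emb_def[abs_def]
  by (intro bounded_linear_add bounded_linear_scaleR_const bounded_linear_vec_nth)

lemma inner_self_has_derivative:
  "((\<lambda>u. u \<bullet> u) has_derivative (\<lambda>v. 2 * (u \<bullet> v))) (at u)"
  by (auto intro!: derivative_eq_intros simp: inner_commute)

lemma stereo_has_derivative: "(stereo s has_derivative stereo_deriv s u) (at u)"
proof -
  let ?n = "u \<bullet> u + 1"
  have "((\<lambda>x. 2 / (x + 1)) has_real_derivative - (2 / ?n\<^sup>2)) (at (u \<bullet> u))"
    using norm2_plus_1_pos[of u] by (auto intro!: derivative_eq_intros simp: power2_eq_square)
  from has_derivative_compose[OF inner_self_has_derivative has_field_derivative_imp_has_derivative[OF this]]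
  have r: "((\<lambda>u. 2 / (u \<bullet> u + 1)) has_derivative (\<lambda>v. - (4 * (u \<bullet> v) / ?n\<^sup>2))) (at u)"
    by (simp add: mult_ac)
  have "((\<lambda>u. (2 / (u \<bullet> u + 1)) *\<^sub>R plane_emb u + (s * (1 - 2 / (u \<bullet> u + 1))) *\<^sub>R axis 3 1) has_derivative
      (\<lambda>v. ((2 / ?n) *\<^sub>R plane_emb v + (- (4 * (u \<bullet> v) / ?n\<^sup>2)) *\<^sub>R plane_emb u)
        + (s * (0 - - (4 * (u \<bullet> v) / ?n\<^sup>2))) *\<^sub>R axis 3 1)) (at u)"
    by (intro has_derivative_add has_derivative_scaleR has_derivative_scaleR_left has_derivative_mult_right
        has_derivative_diff has_derivative_const r bounded_linear_imp_has_derivative bounded_linear_plane_emb)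
  moreover have "((2 / ?n) *\<^sub>R plane_emb v + (- (4 * (u \<bullet> v) / ?n\<^sup>2)) *\<^sub>R plane_emb u)
        + (s * (0 - - (4 * (u \<bullet> v) / ?n\<^sup>2))) *\<^sub>R axis 3 1 = stereo_deriv s u v" for v
    unfolding stereo_deriv_def
    by (simp add: scaleR_diff_right mult.commute)
  ultimately show ?thesis
    by (simp add: stereo_eq[abs_def])
qed

lemma inner_plane_emb: "plane_emb u \<bullet> plane_emb v = u \<bullet> v" "plane_emb u \<bullet> axis 3 1 = 0" 
  by (simp_all add: plane_emb_def inner_vec_def sum_2 sum_3 axis_def)

lemma inner_axis_3: "(axis 3 1 :: real^3) \<bullet> plane_emb u = 0" "(axis 3 1 :: real^3) \<bullet> axis 3 1 = 1"
  by (simp_all add: plane_emb_def inner_vec_def sum_3 axis_def)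

text \<open>
  Stereographic projection is conformal.
\<close>

lemma stereo_deriv_inner:
  assumes "s\<^sup>2 = 1"
  shows "stereo_deriv s u v \<bullet> stereo_deriv s u w = 4 / (u \<bullet> u + 1)\<^sup>2 * (v \<bullet> w)"
proof -
  let ?n = "u \<bullet> u + 1"
  have n: "?n \<noteq> 0" using norm2_plus_1_pos[of u] by simp
  have s: "s * s = 1" using assms by (simp add: power2_eq_square)
  have inner: "(\<alpha> *\<^sub>R plane_emb v - \<beta> *\<^sub>R (plane_emb u - s *\<^sub>R axis 3 1)) \<bullet>
      (\<alpha> *\<^sub>R plane_emb w - \<gamma> *\<^sub>R (plane_emb u - s *\<^sub>R axis 3 1)) =
      \<alpha> * \<alpha> * (v \<bullet> w) - \<alpha> * \<gamma> * (u \<bullet> v) - \<alpha> * \<beta> * (u \<bullet> w) + \<beta> * \<gamma> * (u \<bullet> u + s * s)" for \<alpha> \<beta> \<gamma>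
    by (simp add: inner_diff inner_plane_emb inner_axis_3 inner_commute[of v u] algebra_simps)
  have cancel: "(2 / n) * (2 / n) * c - (2 / n) * (4 * b / n\<^sup>2) * a - (2 / n) * (4 * a / n\<^sup>2) * b
      + (4 * a / n\<^sup>2) * (4 * b / n\<^sup>2) * n = 4 / n\<^sup>2 * c" if "n \<noteq> 0" for a b c n :: real
    using that by (simp add: field_simps power2_eq_square)
  show ?thesis
    by (simp only: stereo_deriv_def inner s cancel[OF n])
qed

lemma stereo_nth_3: "stereo s u $ 3 = s * (1 - 2 / (u \<bullet> u + 1))"
  by (simp add: stereo_eq plane_emb_def axis_def)

text \<open>
  Stereographic projection from the pole \<open>(0, 0, s)\<close>, the inverse of the chart \<open>stereo s\<close>.
\<close>

definition stereo_proj :: "real \<Rightarrow> real^3 \<Rightarrow> real^2"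
  where "stereo_proj s p = (1 / (1 - s * p $ 3)) *\<^sub>R (p $ 1 *\<^sub>R axis 1 1 + p $ 2 *\<^sub>R axis 2 1)"

lemma chart_denominator_nonzero:
  fixes s z :: real
  assumes "s\<^sup>2 = 1" "z \<noteq> s"
  shows "1 - s * z \<noteq> 0"
proof
  assume "1 - s * z = 0"
  then have "s * z = 1" by simp
  then have "s\<^sup>2 * z = s" by (simp add: power2_eq_square mult.assoc)
  then show False using assms by simp
qed

lemma stereo_stereo_proj:
  assumes "p \<in> S2" "s\<^sup>2 = 1" "p $ 3 \<noteq> s"
  shows "stereo s (stereo_proj s p) = p"
proof -
  let ?d = "1 - s * p $ 3"
  have s: "s * s = 1" using assms(2) by (simp add: power2_eq_square)
  have d: "?d \<noteq> 0" using assms by (intro chart_denominator_nonzero)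
  have "p \<bullet> p = 1" using assms(1) by (simp add: dot_square_norm)
  then have p: "p $ 1 * p $ 1 + p $ 2 * p $ 2 = 1 - p $ 3 * p $ 3"
    by (simp add: inner_vec_def sum_3)
  have factor: "1 - p $ 3 * p $ 3 = ?d * (1 + s * p $ 3)"
    using s by (simp add: algebra_simps)
  have "stereo_proj s p \<bullet> stereo_proj s p = (p $ 1 * p $ 1 + p $ 2 * p $ 2) / (?d * ?d)"
    by (simp add: stereo_proj_def inner_vec_def sum_2 axis_def add_divide_distrib)
  also have "\<dots> = (1 + s * p $ 3) / ?d"
    unfolding p factor using d by simp
  finally have q: "stereo_proj s p \<bullet> stereo_proj s p = (1 + s * p $ 3) / ?d" .
  have "2 / ((1 + \<sigma>) / (1 - \<sigma>) + 1) = 1 - \<sigma>" if "1 - \<sigma> \<noteq> 0" for \<sigma> :: real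
  proof -
    have "(1 + \<sigma>) / (1 - \<sigma>) + 1 = 2 / (1 - \<sigma>)"
      using that by (simp add: field_simps)
    then show ?thesis by simp
  qed
  from this[OF d] have q: "2 / (stereo_proj s p \<bullet> stereo_proj s p + 1) = ?d"
    unfolding q .
  have "stereo s (stereo_proj s p) = ?d *\<^sub>R plane_emb (stereo_proj s p) + (s * (1 - ?d)) *\<^sub>R axis 3 1"
    unfolding stereo_eq q ..
  also have "\<dots> = p"
    using d s by (simp add: vec_eq_iff forall_3 plane_emb_def stereo_proj_def axis_def mult.assoc[symmetric])
  finally show ?thesis .
qed

lemma atlas_eq: "\<phi> \<in> atlas \<longleftrightarrow> (\<exists>s. s\<^sup>2 = 1 \<and> \<phi> = stereo s)"
  by (auto simp: atlas_def power2_eq_1_iff)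


section \<open>Conformal changes of the round metric along the polar axis\<close>

definition conformal_metric :: "(real \<Rightarrow> real) \<Rightarrow> metric"
  where "conformal_metric \<Phi> p v w = exp (2 * \<Phi> (p $ 3)) * (v \<bullet> w)"

lemma metric_coeffs_conformal:
  assumes "s\<^sup>2 = 1"
  shows "metric_coeffs (conformal_metric \<Phi>) (stereo s) u =
    scalar_matrix (exp (2 * \<Phi> (stereo s u $ 3)) * (4 / (u \<bullet> u + 1)\<^sup>2))"
proof -
  have "axis i 1 \<bullet> (axis j 1 :: real^2) = of_bool (i = j)" for i j
    by (simp add: inner_axis_axis)
  then show ?thesis
    using assms
    by (simp add: metric_coeffs_def conformal_metric_def partial_eq[OF stereo_has_derivative]
        stereo_deriv_inner scalar_matrix_def vec_eq_iff)
qed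

lemma smooth_on_inner_self: "smooth_on UNIV (\<lambda>u :: real^2. u \<bullet> u)"
proof -
  have "smooth_on UNIV (\<lambda>u :: real^2. u $ 1 * u $ 1 + u $ 2 * u $ 2)"
    by (intro smooth_on_add smooth_on_mult smooth_on_bounded_linear bounded_linear_vec_nth)
  then show ?thesis by (simp add: inner_vec_def sum_2)
qed

lemma riemannian_metric_conformal:
  assumes "\<And>z :: real^2 \<Rightarrow> real. smooth_on UNIV z \<Longrightarrow> smooth_on UNIV (\<lambda>u. \<Phi> (z u))"
  shows "riemannian_metric (conformal_metric \<Phi>)"
proof -
  have r: "smooth_on UNIV (\<lambda>u :: real^2. inverse (u \<bullet> u + 1))"
    by (intro smooth_on_inverse smooth_on_add smooth_on_inner_self smooth_on_const)
       (metis norm2_plus_1_pos less_irrefl)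
  have z: "smooth_on UNIV (\<lambda>u :: real^2. s + (- 2 * s) * inverse (u \<bullet> u + 1))" for s
    by (intro smooth_on_add smooth_on_mult smooth_on_const r)
  have "smooth_on UNIV (\<lambda>u. metric_coeffs (conformal_metric \<Phi>) (stereo s) u $ i $ j)" if "s\<^sup>2 = 1" for s i j
  proof -
    have "smooth_on UNIV (\<lambda>u :: real^2. (exp (2 * \<Phi> (s + (- 2 * s) * inverse (u \<bullet> u + 1)))
        * (4 * (inverse (u \<bullet> u + 1) * inverse (u \<bullet> u + 1)))) * of_bool (i = j))"
      by (intro smooth_on_mult smooth_on_exp smooth_on_const r assms z)
    moreover have "metric_coeffs (conformal_metric \<Phi>) (stereo s) u $ i $ j =
        (exp (2 * \<Phi> (s + (- 2 * s) * inverse (u \<bullet> u + 1)))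
        * (4 * (inverse (u \<bullet> u + 1) * inverse (u \<bullet> u + 1)))) * of_bool (i = j)" for u
    proof -
      have "stereo s u $ 3 = s + (- 2 * s) * inverse (u \<bullet> u + 1)"
        by (simp add: stereo_nth_3 right_diff_distrib divide_inverse)
      then show ?thesis
        unfolding metric_coeffs_conformal[OF that] scalar_matrix_nth
        by (simp add: divide_inverse power2_eq_square)
    qed
    ultimately show ?thesis by simp
  qed
  then show ?thesis
    unfolding riemannian_metric_def
    by (auto simp: conformal_metric_def inner_commute inner_add_right algebra_simps atlas_eq)
qed

text \<open>
  With \<open>\<Phi>1\<close>, \<open>\<Phi>2\<close> the derivatives of \<open>\<Phi>\<close>, the expression \<open>(1 - z\<^sup>2) * \<Phi>2 z - 2 * z * \<Phi>1 z\<close> is the Laplacian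
  on the round sphere of a function of the height, so the assumption is the curvature equation
  \<open>K = (1 - \<Delta> \<Phi>) / exp (2 * \<Phi>)\<close> turned into an inequality.  In a chart everything is a function of
  \<open>q = u \<bullet> u\<close>: the height is \<open>z q\<close> and the conformal factor is \<open>exp (2 * W q)\<close>, where \<open>W\<close> combines \<open>\<Phi>\<close> with the
  factor of the round metric.
\<close>

lemma sectional_curvature_le_conformal:
  assumes D1: "\<And>z. (\<Phi> has_real_derivative \<Phi>1 z) (at z)"
    and D2: "\<And>z. (\<Phi>1 has_real_derivative \<Phi>2 z) (at z)"
    and ineq: "\<And>z. -1 \<le> z \<Longrightarrow> z \<le> 1 \<Longrightarrow> 1 - ((1 - z\<^sup>2) * \<Phi>2 z - 2 * z * \<Phi>1 z) \<le> c * exp (2 * \<Phi> z)"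
    and "0 \<le> c"
  shows "sectional_curvature_le (conformal_metric \<Phi>) c"
  unfolding sectional_curvature_le_def
proof (intro ballI allI impI)
  fix \<phi> :: "real^2 \<Rightarrow> real^3" and u a b :: "real^2"
  assume "\<phi> \<in> atlas"
  then obtain s where s: "s\<^sup>2 = 1" and \<phi>: "\<phi> = stereo s" by (auto simp: atlas_eq)
  define G where "G = metric_coeffs (conformal_metric \<Phi>) \<phi>"
  define z where "z q = s * (1 - 2 / (q + 1))" for q :: real
  define W where "W q = \<Phi> (z q) + ln 2 - ln (q + 1)" for q :: real
  define W1 where "W1 q = \<Phi>1 (z q) * (2 * s / (q + 1)\<^sup>2) - 1 / (q + 1)" for q :: real
  define W2 where "W2 q = \<Phi>2 (z q) * (2 * s / (q + 1)\<^sup>2) * (2 * s / (q + 1)\<^sup>2)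
      - \<Phi>1 (z q) * (4 * s / (q + 1) ^ 3) + 1 / (q + 1)\<^sup>2" for q :: real
  have dz: "(z has_real_derivative 2 * s / (q + 1)\<^sup>2) (at q)" if "q \<ge> 0" for q
    using that unfolding z_def[abs_def] by (auto intro!: derivative_eq_intros simp: power2_eq_square field_simps)
  have dW: "(W has_real_derivative W1 q) (at q)" if "q \<ge> 0" for q
    using that unfolding W_def[abs_def] W1_def
    by (auto intro!: derivative_eq_intros DERIV_chain2[OF D1] dz simp: field_simps)
  have dW1: "(W1 has_real_derivative W2 q) (at q)" if "q \<ge> 0" for q
  proof -
    have "((\<lambda>n. 2 * s / n\<^sup>2) has_real_derivative - (4 * s / n ^ 3)) (at n)" if "n \<noteq> 0" for n
      using that by (auto intro!: derivative_eq_intros simp: power2_eq_square power3_eq_cube field_simps)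
    from this[of "q + 1"] have "((\<lambda>q. 2 * s / (q + 1)\<^sup>2) has_real_derivative - (4 * s / (q + 1) ^ 3)) (at q)"
      using that by (simp add: DERIV_shift)
    moreover have "((\<lambda>q. 1 / (q + 1)) has_real_derivative - (1 / (q + 1)\<^sup>2)) (at q)"
      using that by (auto intro!: derivative_eq_intros simp: power2_eq_square)
    ultimately have "(W1 has_real_derivative (\<Phi>2 (z q) * (2 * s / (q + 1)\<^sup>2)) * (2 * s / (q + 1)\<^sup>2)
        + - (4 * s / (q + 1) ^ 3) * \<Phi>1 (z q) - - (1 / (q + 1)\<^sup>2)) (at q)"
      unfolding W1_def[abs_def] by (intro DERIV_diff DERIV_mult DERIV_chain2[OF D2 dz[OF that]])
    then show ?thesis
      by (simp add: W2_def mult.commute)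
  qed
  have sq: "((\<lambda>x. x \<bullet> x) has_derivative (\<lambda>v. 2 * (x \<bullet> v))) (at x)" for x :: "real^2"
    by (rule inner_self_has_derivative)
  define w where "w x = W (x \<bullet> x)" for x :: "real^2"
  define dw where "dw x = (2 * W1 (x \<bullet> x)) *\<^sub>R x" for x :: "real^2"
  define H :: "real^2^2" where
    "H = (\<chi> i j. 4 * W2 (u \<bullet> u) * u $ i * u $ j + 2 * W1 (u \<bullet> u) * of_bool (i = j))"
  have w: "(w has_derivative (\<lambda>v. dw x \<bullet> v)) (at x)" for x
  proof -
    from has_derivative_compose[OF sq has_field_derivative_imp_has_derivative[OF dW[OF inner_ge_zero]]]
    show ?thesis unfolding w_def[abs_def] dw_def by (simp add: mult_ac)
  qed
  have hess: "((\<lambda>x. dw x $ i) has_derivative (\<lambda>v. H $ i \<bullet> v)) (at u)" for i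
  proof -
    have "((\<lambda>x. W1 (x \<bullet> x)) has_derivative (\<lambda>v. W2 (u \<bullet> u) * (2 * (u \<bullet> v)))) (at u)"
      by (rule has_derivative_compose[OF sq has_field_derivative_imp_has_derivative[OF dW1[OF inner_ge_zero]]])
    then have "((\<lambda>x. dw x $ i) has_derivative
        (\<lambda>v. 2 * W1 (u \<bullet> u) * v $ i + 2 * (W2 (u \<bullet> u) * (2 * (u \<bullet> v))) * u $ i)) (at u)"
      unfolding dw_def[abs_def]
      by (auto intro!: derivative_eq_intros bounded_linear.has_derivative[OF bounded_linear_vec_nth])
    moreover have "H $ i \<bullet> v = 2 * W1 (u \<bullet> u) * v $ i + 2 * (W2 (u \<bullet> u) * (2 * (u \<bullet> v))) * u $ i" for v
      using exhaust_2[of i] by (auto simp: H_def inner_vec_def sum_2 algebra_simps)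
    ultimately show ?thesis by simp
  qed
  have H_sym: "H $ i $ j = H $ j $ i" for i j
    by (simp add: H_def mult_ac)
  have exp_W: "exp (2 * W q) = exp (2 * \<Phi> (z q)) * (4 / (q + 1)\<^sup>2)" if "q \<ge> 0" for q
  proof -
    have "exp (2 * W q) = (exp (W q))\<^sup>2" by (simp add: exp_double)
    also have "exp (W q) = exp (\<Phi> (z q)) * (2 / (q + 1))"
      using that by (simp add: W_def exp_diff exp_add)
    finally show ?thesis by (simp add: power_mult_distrib power_divide exp_double)
  qed
  have G: "G x = scalar_matrix (exp (2 * w x))" for x
    by (simp add: G_def \<phi> metric_coeffs_conformal[OF s] stereo_nth_3 w_def exp_W z_def)
  show "sectional_curvature G u a b \<le> c"
  \<comment> \<open>For linearly dependent vectors the curvature is a quotient by \<open>0\<close>, which is \<open>0\<close>.\<close>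
  proof (cases "a $ 1 * b $ 2 = a $ 2 * b $ 1")
    case True
    have "(k * (a \<bullet> a)) * (k * (b \<bullet> b)) - (k * (a \<bullet> b))\<^sup>2 = k\<^sup>2 * (a $ 1 * b $ 2 - a $ 2 * b $ 1)\<^sup>2" for k
      by (simp add: inner_vec_def sum_2 power2_eq_square algebra_simps)
    then show ?thesis
      unfolding sectional_curvature_def coord_inner_scalar_matrix[OF G]
      using True \<open>0 \<le> c\<close> by simp
  next
    case False
    define q where "q = u \<bullet> u"
    have q: "q \<ge> 0" by (simp add: q_def)
    let ?z = "z q"
    have "?z * ?z = (1 - 2 / (q + 1))\<^sup>2"
      using s by (simp add: z_def power2_eq_square algebra_simps)
    then have z2: "?z\<^sup>2 = (1 - 2 / (q + 1))\<^sup>2" by (simp add: power2_eq_square)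
    have "\<bar>1 - 2 / (q + 1)\<bar> \<le> 1" using q by (auto simp: field_simps abs_le_iff)
    with z2 have "\<bar>?z\<bar> \<le> 1" by (metis power2_eq_iff abs_minus_cancel abs_le_square_iff one_power2 abs_one)
    then have z_range: "-1 \<le> ?z" "?z \<le> 1" by auto
    \<comment> \<open>The Laplacian in the plane of the radial function \<open>W (u \<bullet> u)\<close>.\<close>
    have trace: "H $ 1 $ 1 + H $ 2 $ 2 = 4 * (q * W2 q + W1 q)"
      by (simp add: H_def q_def inner_vec_def sum_2 algebra_simps)
    \<comment> \<open>With \<open>n = q + 1\<close> as the variable, clearing denominators does not expand the powers of \<open>q + 1\<close>.\<close>
    have collect: "(n - 1) * (A * (2 * s / n\<^sup>2) * (2 * s / n\<^sup>2) - B * (4 * s / n ^ 3) + 1 / n\<^sup>2) + (B * (2 * s / n\<^sup>2) - 1 / n)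
        = A * (4 * (n - 1) * s\<^sup>2 / n ^ 4) + B * (2 * s * (2 - n) / n ^ 3) - 1 / n\<^sup>2"
      if "n \<noteq> 0" for n A B :: real
      using that by (simp add: field_simps power2_eq_square power3_eq_cube power4_eq_xxxx)
    have "q * W2 q + W1 q = \<Phi>2 ?z * (4 * q * s\<^sup>2 / (q + 1) ^ 4)
        + \<Phi>1 ?z * (2 * s * (1 - q) / (q + 1) ^ 3) - 1 / (q + 1)\<^sup>2"
      using q collect[of "q + 1" "\<Phi>2 ?z" "\<Phi>1 ?z"] by (simp add: W1_def W2_def)
    also have "\<dots> = (1 / (q + 1)\<^sup>2) * ((1 - ?z\<^sup>2) * \<Phi>2 ?z - 2 * ?z * \<Phi>1 ?z - 1)"
    proof -
      have "1 - ?z\<^sup>2 = 4 * q / (q + 1)\<^sup>2"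
      proof -
        have "1 - (1 - 2 / n)\<^sup>2 = 4 * (n - 1) / n\<^sup>2" if "n \<noteq> 0" for n :: real
          using that by (simp add: field_simps power2_eq_square)
        from this[of "q + 1"] show ?thesis using q by (simp add: z2)
      qed
      moreover have "?z = s * (q - 1) / (q + 1)"
        using q unfolding z_def by (simp add: field_simps)
      moreover have "A * (4 * q * s\<^sup>2 / n ^ 4) + B * (2 * s * (1 - q) / n ^ 3) - 1 / n\<^sup>2
          = (1 / n\<^sup>2) * (Z2 * A - 2 * Z * B - 1)"
        if "Z2 = 4 * q / n\<^sup>2" "Z = s * (q - 1) / n" "n \<noteq> 0" for A B Z2 Z n :: real
        using that(3) unfolding that(1,2) s
        by (simp add: field_simps power2_eq_square power3_eq_cube power4_eq_xxxx)
      ultimately show ?thesis using q by simp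
    qed
    finally have laplacian: "q * W2 q + W1 q = (1 / (q + 1)\<^sup>2) * ((1 - ?z\<^sup>2) * \<Phi>2 ?z - 2 * ?z * \<Phi>1 ?z - 1)" .
    have "- (4 * (1 / m * (Y - 1))) = 4 / m * (1 - Y)" for m Y :: real
      by (simp add: algebra_simps diff_divide_distrib)
    then have lap: "- (H $ 1 $ 1 + H $ 2 $ 2) = (4 / (q + 1)\<^sup>2) * (1 - ((1 - ?z\<^sup>2) * \<Phi>2 ?z - 2 * ?z * \<Phi>1 ?z))"
      by (simp only: trace laplacian)
    have "sectional_curvature G u a b = - (H $ 1 $ 1 + H $ 2 $ 2) / exp (2 * w u)"
      by (rule sectional_curvature_conformal[OF G w hess H_sym False])
    also have "\<dots> \<le> c"
      unfolding lap w_def q_def[symmetric] exp_W[OF q]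
      using ineq[OF z_range] q by (simp add: divide_le_eq)
    finally show ?thesis .
  qed
qed


section \<open>The conformal factor of the balloon\<close>

lemma exp_ge_quartic:
  assumes "0 \<le> (x :: real)"
  shows "x ^ 4 / 24 \<le> exp x"
proof -
  obtain t where t: "exp x = (\<Sum>m<5. x ^ m / fact m) + exp t / fact 5 * x ^ 5"
    using Maclaurin_exp_le by blast
  have "x ^ 4 / fact 4 \<le> (\<Sum>m<5. x ^ m / fact m)"
    using assms by (intro member_le_sum) auto
  moreover have "0 \<le> exp t / fact 5 * x ^ 5"
    using assms by simp
  ultimately have "x ^ 4 / fact 4 + 0 \<le> exp x"
    unfolding t by (rule add_mono)
  then show ?thesis
    by (simp add: fact_numeral)
qed

text \<open>
  Half the logarithm of the conformal factor, with \<open>C = 1000\<close>.  Any sufficiently large constant would do: the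
  curvature bound uses \<open>C \<ge> 216\<close> and the distance bound \<open>C \<ge> 864\<close>.
\<close>

definition bump_exponent :: "real \<Rightarrow> real"
  where "bump_exponent z = 1000 * flat_exp 1 (- z)"

text \<open>
  With \<open>x = - (1 / z)\<close> and \<open>\<Phi> = C * exp (- x)\<close> the Laplacian of \<open>\<Phi>\<close> is \<open>\<Phi> * (x ^ 4 - 2 * x ^ 3 - x\<^sup>2)\<close>, and
  \<open>exp (2 * \<Phi>) - 1\<close> is at least \<open>\<Phi> * (2 + 2 * \<Phi>)\<close>.  So it suffices that
  \<open>x ^ 4 - 2 * x ^ 3 - x\<^sup>2 + 2 + 2 * \<Phi>\<close> is nonnegative.  For \<open>x \<ge> 3\<close>, in the neck, the polynomial is; for
  \<open>x < 3\<close> it is at least \<open>- 18\<close>, which \<open>2 * \<Phi>\<close> compensates.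
\<close>

lemma bump_curvature:
  fixes z :: real
  defines "p1 \<equiv> flat_exp_deriv_poly 1" and "p2 \<equiv> flat_exp_deriv_poly (flat_exp_deriv_poly 1)"
  shows "1 - ((1 - z\<^sup>2) * (1000 * flat_exp p2 (- z)) - 2 * z * (- (1000 * flat_exp p1 (- z)))) \<le> exp (2 * bump_exponent z)"
proof (cases "z < 0")
  case False
  then show ?thesis by (simp add: flat_exp_def bump_exponent_def)
next
  case True
  define x where "x = - (1 / z)"
  have x: "x > 0" "1 / (- z) = x" and z: "z = - (1 / x)" using True by (auto simp: x_def)
  let ?E = "exp (- x)"
  have F: "flat_exp p1 (- z) = x\<^sup>2 * ?E" "flat_exp p2 (- z) = (x ^ 4 - 2 * x ^ 3) * ?E"
    using True unfolding flat_exp_def x(2)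
    by (simp_all add: p1_def p2_def flat_exp_deriv_poly_def one_pCons pderiv_pCons)
       (simp_all add: algebra_simps power2_eq_square power3_eq_cube power4_eq_xxxx)
  have lhs: "(1 - z\<^sup>2) * (1000 * flat_exp p2 (- z)) - 2 * z * (- (1000 * flat_exp p1 (- z)))
      = 1000 * ?E * (x ^ 4 - 2 * x ^ 3 - x\<^sup>2)"
    using x(1) unfolding F unfolding z by (simp add: field_simps power2_eq_square power3_eq_cube power4_eq_xxxx)
  have "1 + 2 * (1000 * ?E) + (2 * (1000 * ?E))\<^sup>2 / 2 \<le> exp (2 * (1000 * ?E))"
    by (rule exp_lower_Taylor_quadratic) simp
  moreover have "0 \<le> x ^ 4 - 2 * x ^ 3 - x\<^sup>2 + 2 + 2 * (1000 * ?E)"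
  proof -
    have poly: "x ^ 4 - 2 * x ^ 3 - x\<^sup>2 = x\<^sup>2 * ((x - 1)\<^sup>2 - 2)"
      by (simp add: algebra_simps power2_eq_square power3_eq_cube power4_eq_xxxx)
    show ?thesis
    proof (cases "x \<ge> 3")
      case True
      then have "2\<^sup>2 \<le> (x - 1)\<^sup>2" by (intro power_mono) auto
      then have "0 \<le> x\<^sup>2 * ((x - 1)\<^sup>2 - 2)" by (intro mult_nonneg_nonneg) auto
      then show ?thesis unfolding poly by (smt (verit) exp_gt_zero)
    next
      case False
      then have "x\<^sup>2 \<le> 3\<^sup>2" using x by (intro power_mono) auto
      moreover have "x\<^sup>2 * ((x - 1)\<^sup>2 - 2) \<ge> x\<^sup>2 * (- 2)" by (intro mult_left_mono) auto
      ultimately have "x\<^sup>2 * ((x - 1)\<^sup>2 - 2) \<ge> - 18" by simp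
      moreover have "?E \<ge> 1 / 27"
      proof -
        have "exp x \<le> exp (real 3 * 1)" using False by simp
        also have "\<dots> = exp 1 ^ 3" by (rule exp_of_nat_mult)
        also have "\<dots> \<le> 3 ^ 3" using exp_le by (intro power_mono) auto
        finally have "exp x \<le> 27" by simp
        then show ?thesis by (simp add: exp_minus field_simps)
      qed
      ultimately show ?thesis unfolding poly by simp
    qed
  qed
  then have "0 \<le> 1000 * ?E * (x ^ 4 - 2 * x ^ 3 - x\<^sup>2 + 2 + 2 * (1000 * ?E))"
    by simp
  moreover have "bump_exponent z = 1000 * ?E"
    using True unfolding bump_exponent_def flat_exp_def x(2) by simp
  ultimately show ?thesis
    unfolding lhs by (simp add: algebra_simps power2_eq_square)
qed

text \<open>
  The function \<open>12 * exp (1 / z)\<close> of the height (for \<open>z < 0\<close>) changes at most at unit rate along unit speed curves of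
  the new metric, because its derivative stays below the dilation factor \<open>exp \<Phi>\<close>.  In terms of
  \<open>x = - (1 / z)\<close> this follows from \<open>12 * x\<^sup>2 \<le> exp x + C\<close>, and that from \<open>x ^ 4 / 24 \<le> exp x\<close>.
\<close>

lemma bump_height:
  shows "\<bar>12 * flat_exp (flat_exp_deriv_poly 1) (- z)\<bar> \<le> exp (bump_exponent z)"
proof (cases "z < 0")
  case False
  then show ?thesis by (simp add: flat_exp_def)
next
  case True
  define x where "x = - (1 / z)"
  have x: "x > 0" "1 / (- z) = x" using True by (auto simp: x_def)
  \<comment> \<open>Divided by \<open>24\<close> this is \<open>12 * x\<^sup>2 \<le> x ^ 4 / 24 + 864\<close>.\<close>
  have "0 \<le> (x\<^sup>2 - 144)\<^sup>2" by simp
  then have "12 * x\<^sup>2 \<le> x ^ 4 / 24 + 1000"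
    by (simp add: power2_diff)
  also have "\<dots> \<le> exp x + 1000" using exp_ge_quartic[of x] x by simp
  finally have "12 * (x\<^sup>2 * exp (- x)) \<le> (exp x + 1000) * exp (- x)"
    by (simp add: mult_right_mono)
  also have "\<dots> = 1 + 1000 * exp (- x)" by (simp add: distrib_right exp_minus)
  also have "\<dots> \<le> exp (1000 * exp (- x))" by (rule exp_ge_add_one_self)
  finally show ?thesis
    using True unfolding bump_exponent_def flat_exp_def x(2)
    by (simp add: flat_exp_deriv_poly_def power2_eq_square)
qed


section \<open>Minimizing geodesics and open hemispheres\<close>

lemma unit_inner_range:
  assumes "norm x = 1" "norm y = 1"
  shows "-1 \<le> x \<bullet> y" "x \<bullet> y \<le> 1"
  using Cauchy_Schwarz_ineq2[of x y] assms by auto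

lemma unit_inner_eq_1: "norm x = 1 \<Longrightarrow> norm y = 1 \<Longrightarrow> x \<bullet> y = 1 \<Longrightarrow> x = y"
  using norm_cauchy_schwarz_eq[of x y] by simp

text \<open>
  If \<open>m\<close> gives equality in the triangle inequality for angles, then it lies on the great circle arc from \<open>x\<close>
  to \<open>y\<close>.  Writing \<open>\<alpha>\<close>, \<open>\<beta>\<close> for the angles at either side of \<open>m\<close>, this takes the form
  \<open>sin (\<alpha> + \<beta>) * m = sin \<beta> * x + sin \<alpha> * y\<close>: the squared norm of the difference is at most \<open>0\<close>.
  A nonnegative combination of vectors in the half-space is again in the half-space.
\<close>

lemma between_points_of_hemisphere:
  fixes x y m n :: "'a::real_inner"
  assumes unit: "norm x = 1" "norm y = 1" "norm m = 1"
    and between: "arccos (x \<bullet> m) + arccos (m \<bullet> y) \<le> arccos (x \<bullet> y)"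
    and neg: "n \<bullet> x < 0" "n \<bullet> y < 0"
  shows "n \<bullet> m < 0"
proof (rule ccontr)
  assume "\<not> n \<bullet> m < 0"
  define \<alpha> \<beta> \<theta> where "\<alpha> = arccos (x \<bullet> m)" and "\<beta> = arccos (m \<bullet> y)" and "\<theta> = arccos (x \<bullet> y)"
  have cos: "x \<bullet> m = cos \<alpha>" "m \<bullet> y = cos \<beta>" "x \<bullet> y = cos \<theta>"
    and range: "0 \<le> \<alpha>" "\<alpha> \<le> pi" "0 \<le> \<beta>" "\<beta> \<le> pi" "0 \<le> \<theta>" "\<theta> \<le> pi"
    using unit_inner_range[OF unit(1,3)] unit_inner_range[OF unit(3,2)] unit_inner_range[OF unit(1,2)]
    by (simp_all add: \<alpha>_def \<beta>_def \<theta>_def arccos_lbound arccos_ubound)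
  have sum_le: "\<alpha> + \<beta> \<le> \<theta>" using between by (simp add: \<alpha>_def \<beta>_def \<theta>_def)
  have "\<theta> \<noteq> pi"
  proof
    assume "\<theta> = pi"
    then have "x \<bullet> (- y) = 1" using cos(3) by simp
    then have "x = - y" using unit_inner_eq_1[of x "- y"] unit by simp
    then show False using neg by simp
  qed
  have sin: "0 \<le> sin \<alpha>" "0 \<le> sin \<beta>" "0 \<le> sin (\<alpha> + \<beta>)"
    using range sum_le by (auto intro: sin_ge_zero)
  have cos_le: "cos \<theta> \<le> cos (\<alpha> + \<beta>)"
    using range sum_le by (intro cos_monotone_0_pi_le) auto
  let ?v = "sin \<beta> *\<^sub>R x + sin \<alpha> *\<^sub>R y - sin (\<alpha> + \<beta>) *\<^sub>R m"
  have "x \<bullet> x = 1" "y \<bullet> y = 1" "m \<bullet> m = 1"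
    using unit by (simp_all add: dot_square_norm)
  then have "?v \<bullet> ?v = (sin \<beta>)\<^sup>2 + (sin \<alpha>)\<^sup>2 + (sin (\<alpha> + \<beta>))\<^sup>2 + 2 * (sin \<alpha> * sin \<beta> * cos \<theta>)
      - 2 * sin \<beta> * sin (\<alpha> + \<beta>) * cos \<alpha> - 2 * sin \<alpha> * sin (\<alpha> + \<beta>) * cos \<beta>"
    using cos by (simp add: inner_diff inner_add inner_commute[of y x] inner_commute[of m x] inner_commute[of y m]
        power2_eq_square algebra_simps)
  also have "\<dots> \<le> (sin \<beta>)\<^sup>2 + (sin \<alpha>)\<^sup>2 + (sin (\<alpha> + \<beta>))\<^sup>2 + 2 * (sin \<alpha> * sin \<beta> * cos (\<alpha> + \<beta>))
      - 2 * sin \<beta> * sin (\<alpha> + \<beta>) * cos \<alpha> - 2 * sin \<alpha> * sin (\<alpha> + \<beta>) * cos \<beta>"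
    using mult_left_mono[OF cos_le mult_nonneg_nonneg[OF sin(1,2)]] by linarith
  also have "\<dots> = 0"
  proof -
    have "(cos \<alpha>)\<^sup>2 = 1 - (sin \<alpha>)\<^sup>2" "(cos \<beta>)\<^sup>2 = 1 - (sin \<beta>)\<^sup>2"
      by (simp_all add: cos_squared_eq)
    then show ?thesis unfolding sin_add cos_add by algebra
  qed
  finally have "?v \<bullet> ?v = 0" using inner_ge_zero[of ?v] by (rule order_antisym)
  then have "?v = 0" by (simp only: inner_eq_zero_iff)
  then have "n \<bullet> ?v = 0" by simp
  then have "sin \<beta> * (n \<bullet> x) + sin \<alpha> * (n \<bullet> y) = sin (\<alpha> + \<beta>) * (n \<bullet> m)"
    by (simp add: inner_diff_right inner_add_right)
  also have "\<dots> \<ge> 0" using sin \<open>\<not> n \<bullet> m < 0\<close> by simp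
  finally have nonneg: "0 \<le> sin \<beta> * (n \<bullet> x) + sin \<alpha> * (n \<bullet> y)" .
  have "sin \<beta> * (n \<bullet> x) \<le> 0" using sin neg by (simp add: mult_nonneg_nonpos)
  then have "0 \<le> sin \<alpha> * (n \<bullet> y)" using nonneg by linarith
  then have "sin \<alpha> = 0" using sin neg by (auto simp: zero_le_mult_iff)
  moreover have "\<alpha> < pi" using range sum_le \<open>\<theta> \<noteq> pi\<close> by linarith
  ultimately have "\<alpha> = 0" using range(1) sin_gt_zero[of \<alpha>] by linarith
  then have "x \<bullet> m = 1" using cos(1) by simp
  then have "x = m" using unit_inner_eq_1[of x m] unit by simp
  then show False using neg \<open>\<not> n \<bullet> m < 0\<close> by simp
qed

text \<open>
  The angle \<open>arccos (x \<bullet> \<gamma> t)\<close> from the starting point \<open>x\<close> grows at most at the speed of \<open>\<gamma>\<close>, because the component of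
  \<open>x\<close> tangent to the sphere at \<open>\<gamma> t\<close> has norm \<open>sqrt (1 - (x \<bullet> \<gamma> t)\<^sup>2)\<close>.  This function need not be
  differentiable where \<open>\<gamma>\<close> meets \<open>x\<close> or its antipode, so the estimate is made for \<open>arccos (r * (x \<bullet> \<gamma> t))\<close> with
  \<open>r < 1\<close>, which satisfies the same bound, and then \<open>r\<close> tends to \<open>1\<close>.
\<close>

lemma arccos_le_length:
  fixes \<gamma> :: "real \<Rightarrow> 'a::real_inner"
  assumes "open I" "{a..b} \<subseteq> I" "a \<le> b"
    and deriv: "\<And>t. t \<in> I \<Longrightarrow> (\<gamma> has_vector_derivative \<gamma>' t) (at t)"
    and cont: "continuous_on I \<gamma>'"
    and unit: "\<And>t. t \<in> I \<Longrightarrow> norm (\<gamma> t) = 1"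
  shows "arccos (\<gamma> a \<bullet> \<gamma> b) \<le> integral {a..b} (\<lambda>t. norm (\<gamma>' t))"
proof -
  define x where "x = \<gamma> a"
  have x: "norm x = 1" using assms(2,3) unit by (auto simp: x_def)
  have orth: "\<gamma> t \<bullet> \<gamma>' t = 0" if "t \<in> I" for t
  proof -
    have "((\<lambda>t. \<gamma> t \<bullet> \<gamma> t) has_vector_derivative \<gamma> t \<bullet> \<gamma>' t + \<gamma>' t \<bullet> \<gamma> t) (at t)"
      using deriv[OF that] deriv[OF that] by (rule bounded_bilinear.has_vector_derivative[OF bounded_bilinear_inner])
    moreover have "((\<lambda>t. \<gamma> t \<bullet> \<gamma> t) has_vector_derivative 0) (at t)"
      by (rule has_vector_derivative_transform_within_open[where f = "\<lambda>_. 1" and S = I])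
         (use unit that \<open>open I\<close> in \<open>auto simp: dot_square_norm\<close>)
    ultimately have "\<gamma> t \<bullet> \<gamma>' t + \<gamma>' t \<bullet> \<gamma> t = 0"
      by (rule vector_derivative_unique_at)
    then show ?thesis by (simp add: inner_commute)
  qed
  have bound: "arccos (r * (x \<bullet> \<gamma> b)) - arccos r \<le> integral {a..b} (\<lambda>t. norm (\<gamma>' t))" if r: "r \<in> {0<..<1}" for r
  proof -
    let ?c = "\<lambda>t. x \<bullet> \<gamma> t"
    let ?h' = "\<lambda>t. inverse (- sqrt (1 - (r * ?c t)\<^sup>2)) * (r * (x \<bullet> \<gamma>' t))"
    have c_le: "\<bar>?c t\<bar> \<le> 1" if "t \<in> I" for t
      using unit_inner_range[OF x unit[OF that]] by auto
    have rc: "\<bar>r * ?c t\<bar> < 1" if "t \<in> I" for t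
    proof -
      have "\<bar>r * ?c t\<bar> \<le> r * 1"
        using c_le[OF that] r by (simp add: abs_mult mult_left_le)
      then show ?thesis using r by simp
    qed
    have h: "((\<lambda>t. arccos (r * ?c t)) has_vector_derivative ?h' t) (at t)" if "t \<in> I" for t
    proof -
      have "((\<lambda>t. r * ?c t) has_real_derivative r * (x \<bullet> \<gamma>' t)) (at t)"
        unfolding has_real_derivative_iff_has_vector_derivative
        using deriv[OF that] by (intro derivative_intros bounded_linear.has_vector_derivative[OF bounded_linear_inner_right])
      moreover have "-1 < r * ?c t" "r * ?c t < 1" using rc[OF that] by auto
      ultimately show ?thesis
        unfolding has_real_derivative_iff_has_vector_derivative[symmetric]
        by (intro DERIV_chain2[OF DERIV_arccos])
    qed
    have le: "?h' t \<le> norm (\<gamma>' t)" if "t \<in> I" for t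
    proof -
      have "(r * ?c t)\<^sup>2 < 1" using rc[OF that] by (simp add: abs_square_less_1)
      then have pos: "0 < sqrt (1 - (r * ?c t)\<^sup>2)" by simp
      have "x \<bullet> \<gamma>' t = (x - ?c t *\<^sub>R \<gamma> t) \<bullet> \<gamma>' t"
        using orth[OF that] by (simp add: inner_diff_left)
      also have "\<bar>\<dots>\<bar> \<le> norm (x - ?c t *\<^sub>R \<gamma> t) * norm (\<gamma>' t)"
        by (rule Cauchy_Schwarz_ineq2)
      finally have "r * \<bar>x \<bullet> \<gamma>' t\<bar> \<le> (r * norm (x - ?c t *\<^sub>R \<gamma> t)) * norm (\<gamma>' t)"
        using r by simp
      also have "\<dots> \<le> sqrt (1 - (r * ?c t)\<^sup>2) * norm (\<gamma>' t)"
      proof (intro mult_right_mono real_le_rsqrt)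
        have "(norm (x - ?c t *\<^sub>R \<gamma> t))\<^sup>2 = 1 - (?c t)\<^sup>2"
        proof -
          have "x \<bullet> x = 1" "\<gamma> t \<bullet> \<gamma> t = 1" using x unit[OF that] by (simp_all add: dot_square_norm)
          then show ?thesis
            unfolding power2_norm_eq_inner by (simp add: inner_diff inner_commute[of "\<gamma> t" x] power2_eq_square)
        qed
        moreover have "r\<^sup>2 \<le> 1" using r by (simp add: power_le_one)
        ultimately show "(r * norm (x - ?c t *\<^sub>R \<gamma> t))\<^sup>2 \<le> 1 - (r * ?c t)\<^sup>2"
          by (simp add: power_mult_distrib right_diff_distrib)
      qed simp
      finally have "r * \<bar>x \<bullet> \<gamma>' t\<bar> / sqrt (1 - (r * ?c t)\<^sup>2) \<le> norm (\<gamma>' t)"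
        using pos by (simp add: divide_le_eq mult.commute)
      moreover have "\<bar>?h' t\<bar> = r * \<bar>x \<bullet> \<gamma>' t\<bar> / sqrt (1 - (r * ?c t)\<^sup>2)"
        using pos r by (simp add: abs_mult divide_inverse)
      ultimately show ?thesis using abs_ge_self order_trans by metis
    qed
    have "(?h' has_integral (arccos (r * ?c b) - arccos (r * ?c a))) {a..b}"
    proof (rule fundamental_theorem_of_calculus[where f = "\<lambda>t. arccos (r * ?c t)", OF assms(3)])
      fix t assume "t \<in> {a..b}"
      then show "((\<lambda>t. arccos (r * ?c t)) has_vector_derivative ?h' t) (at t within {a..b})"
        using assms(2) by (blast intro: has_vector_derivative_at_within[OF h])
    qed
    moreover have "((\<lambda>t. norm (\<gamma>' t)) has_integral integral {a..b} (\<lambda>t. norm (\<gamma>' t))) {a..b}"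
      using cont assms(2)
      by (intro integrable_integral integrable_continuous_interval continuous_on_norm) (auto intro: continuous_on_subset)
    ultimately have "arccos (r * ?c b) - arccos (r * ?c a) \<le> integral {a..b} (\<lambda>t. norm (\<gamma>' t))"
      by (rule has_integral_le) (use le assms(2) in auto)
    then show ?thesis using x by (simp add: x_def dot_square_norm)
  qed
  have c: "\<bar>x \<bullet> \<gamma> b\<bar> \<le> 1"
    using unit_inner_range[OF x unit[of b]] assms(2,3) by auto
  have "arccos (1 * (x \<bullet> \<gamma> b)) - arccos 1 \<le> integral {a..b} (\<lambda>t. norm (\<gamma>' t))"
  proof (rule continuous_le_on_closure[where S = "{0<..<1}", OF _ _ bound])
    have "\<bar>r * (x \<bullet> \<gamma> b)\<bar> \<le> 1" if "r \<in> {0..1}" for r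
    proof -
      have "\<bar>r\<bar> * \<bar>x \<bullet> \<gamma> b\<bar> \<le> 1 * 1" using that c by (intro mult_mono) auto
      then show ?thesis by (simp add: abs_mult)
    qed
    then have "continuous_on {0..1} (\<lambda>r. arccos (r * (x \<bullet> \<gamma> b)))"
      by (intro continuous_on_arccos ballI conjI continuous_on_mult_right continuous_on_id)
         (auto simp: abs_le_iff minus_le_iff)
    moreover have "continuous_on {0..1} arccos"
      by (rule continuous_on_subset[OF continuous_on_arccos']) auto
    ultimately show "continuous_on (closure {0<..<1}) (\<lambda>r. arccos (r * (x \<bullet> \<gamma> b)) - arccos r)"
      by (simp add: continuous_on_diff)
  qed auto
  then show ?thesis by (simp add: x_def)
qed

lemma speed_round: "speed round_metric \<gamma> t = norm (vector_derivative \<gamma> (at t))"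
  by (simp add: speed_def round_metric_def norm_eq_sqrt_inner)

text \<open>
  For \<open>y = x\<close> and \<open>y = - x\<close> any direction orthogonal to \<open>x\<close> serves as \<open>e\<close>, which is why the dimension must be
  at least two.
\<close>

lemma great_circle_through:
  fixes x y :: "'a::euclidean_space"
  assumes "2 \<le> DIM('a)" "norm x = 1" "norm y = 1"
  obtains e where "norm e = 1" "x \<bullet> e = 0" "y = cos (arccos (x \<bullet> y)) *\<^sub>R x + sin (arccos (x \<bullet> y)) *\<^sub>R e"
proof -
  define d where "d = y - (x \<bullet> y) *\<^sub>R x"
  have c: "-1 \<le> x \<bullet> y" "x \<bullet> y \<le> 1" using unit_inner_range assms(2,3) by auto
  have xy: "x \<bullet> x = 1" "y \<bullet> y = 1" using assms by (simp_all add: dot_square_norm)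
  have orth: "x \<bullet> d = 0" by (simp add: d_def inner_diff_right xy)
  have "norm d = sqrt (1 - (x \<bullet> y)\<^sup>2)"
    by (simp add: norm_eq_sqrt_inner d_def inner_diff inner_commute[of y x] xy power2_eq_square)
  then have sin: "sin (arccos (x \<bullet> y)) = norm d"
    using c by (simp add: sin_arccos)
  have y: "y = cos (arccos (x \<bullet> y)) *\<^sub>R x + d" using c by (simp add: d_def)
  show ?thesis
  proof (cases "d = 0")
    case True
    obtain f :: 'a where f: "f \<noteq> 0" "orthogonal x f"
      using orthogonal_to_vector_exists[OF assms(1), of x] by auto
    show ?thesis
      by (rule that[of "sgn f"]) (use f y sin True in \<open>auto simp: norm_sgn sgn_div_norm orthogonal_def\<close>)
  next
    case False
    show ?thesis
      by (rule that[of "sgn d"]) (use y sin orth False in \<open>auto simp: norm_sgn sgn_div_norm\<close>)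
  qed
qed

lemma great_circle_speed:
  fixes x e :: "'a::real_inner"
  assumes "norm x = 1" "norm e = 1" "x \<bullet> e = 0"
  defines "p \<equiv> \<lambda>t. cos t *\<^sub>R x + sin t *\<^sub>R e" and "p' \<equiv> \<lambda>t. - sin t *\<^sub>R x + cos t *\<^sub>R e"
  shows "norm (p t) = 1" "norm (p' t) = 1" "(p has_vector_derivative p' t) (at t)"
proof -
  have "x \<bullet> x = 1" "e \<bullet> e = 1" "e \<bullet> x = 0" using assms by (simp_all add: dot_square_norm inner_commute)
  then show "norm (p t) = 1" "norm (p' t) = 1"
    using sin_cos_squared_add[of t] assms(3)
    by (simp_all add: p_def p'_def norm_eq_1 inner_add inner_diff power2_eq_square)
  show "(p has_vector_derivative p' t) (at t)"
    using has_vector_derivative_add[OF has_vector_derivative_scaleR[OF DERIV_cos has_vector_derivative_const]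
        has_vector_derivative_scaleR[OF DERIV_sin has_vector_derivative_const]]
    by (simp add: p_def p'_def)
qed

lemma riem_dist_round_le_arccos:
  assumes "norm x = 1" "norm y = 1"
  shows "riem_dist round_metric x y \<le> arccos (x \<bullet> y)"
proof -
  define \<theta> where "\<theta> = arccos (x \<bullet> y)"
  have \<theta>: "0 \<le> \<theta>" using unit_inner_range[OF assms] by (simp add: \<theta>_def arccos_lbound)
  obtain e where e: "norm e = 1" "x \<bullet> e = 0" "y = cos \<theta> *\<^sub>R x + sin \<theta> *\<^sub>R e"
    using great_circle_through[OF _ assms] unfolding \<theta>_def by auto
  define p where "p t = cos (\<theta> * t) *\<^sub>R x + sin (\<theta> * t) *\<^sub>R e" for t
  define p' where "p' t = \<theta> *\<^sub>R (- sin (\<theta> * t) *\<^sub>R x + cos (\<theta> * t) *\<^sub>R e)" for t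
  note circle = great_circle_speed[OF assms(1) e(1,2)]
  have deriv: "(p has_vector_derivative p' t) (at t)" for t
  proof -
    have "((\<lambda>t. \<theta> * t) has_real_derivative \<theta>) (at t)" by (auto intro!: derivative_eq_intros)
    from vector_diff_chain_at[OF this[unfolded has_real_derivative_iff_has_vector_derivative] circle(3)]
    show ?thesis by (simp add: p_def[abs_def] p'_def o_def)
  qed
  have speed: "speed round_metric p t = \<theta>" for t
    using \<theta> circle(2) vector_derivative_at[OF deriv] by (simp add: speed_round p'_def)
  have "p C1_differentiable_on {0..1}"
    unfolding C1_differentiable_on_def
    using deriv by (intro exI[of _ p']) (auto simp: p'_def[abs_def] intro!: continuous_intros)
  then have "valid_path p"
    by (simp add: valid_path_def C1_differentiable_imp_piecewise)
  moreover have "path_image p \<subseteq> S2"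
    using circle(1) by (auto simp: path_image_def p_def)
  moreover have "pathstart p = x" "pathfinish p = y"
    using e(3) by (simp_all add: pathstart_def pathfinish_def p_def)
  moreover have "speed round_metric p integrable_on {0..1}"
    by (simp add: speed[abs_def] integrable_const_ivl)
  ultimately have "riem_length round_metric p \<in> {riem_length round_metric \<gamma> | \<gamma>. valid_path \<gamma> \<and> path_image \<gamma> \<subseteq> S2 \<and>
              pathstart \<gamma> = x \<and> pathfinish \<gamma> = y \<and> speed round_metric \<gamma> integrable_on {0..1}}" (is "_ \<in> ?L")
    by blast
  moreover have "bdd_below ?L"
    by (rule bdd_belowI[of _ 0]) (auto simp: riem_length_def speed_round intro!: integral_nonneg)
  ultimately have "riem_dist round_metric x y \<le> riem_length round_metric p"
    unfolding riem_dist_def by (rule cInf_lower)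
  also have "\<dots> = \<theta>" by (simp add: riem_length_def speed[abs_def])
  finally show ?thesis by (simp add: \<theta>_def)
qed

text \<open>
  A minimizing segment from \<open>x\<close> to \<open>y\<close> through \<open>m\<close> has length at least the sum of the angles from \<open>x\<close> to \<open>m\<close> and from
  \<open>m\<close> to \<open>y\<close>, and at most the angle from \<open>x\<close> to \<open>y\<close>.
\<close>

lemma s_convex_open_hemisphere: "s_convex round_metric {p \<in> S2. n \<bullet> p < 0}"
  unfolding s_convex_def
proof (intro conjI ballI allI impI)
  fix x y \<gamma>
  assume x: "x \<in> {p \<in> S2. n \<bullet> p < 0}" and y: "y \<in> {p \<in> S2. n \<bullet> p < 0}"
    and min: "minimizing_geodesic_segment round_metric x y \<gamma>"
  then obtain a b where ab: "a < 0" "1 < b" and geo: "geodesic_on round_metric {a<..<b} \<gamma>"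
    and ends: "\<gamma> 0 = x" "\<gamma> 1 = y" and length: "riem_length round_metric \<gamma> = riem_dist round_metric x y"
    unfolding minimizing_geodesic_segment_def geodesic_segment_def pathstart_def pathfinish_def by blast
  let ?I = "{a<..<b}"
  define \<gamma>' where "\<gamma>' t = vector_derivative \<gamma> (at t)" for t
  have "\<gamma> ` ?I \<subseteq> S2"
    using geo unfolding geodesic_on_def by blast
  then have "\<gamma> t \<in> S2" if "t \<in> ?I" for t
    using that by blast
  then have unit: "norm (\<gamma> t) = 1" if "t \<in> ?I" for t
    using that by simp
  have "C_diff_on (Suc 0) ?I \<gamma>"
    using geo unfolding geodesic_on_def smooth_on_def by blast
  then have diff: "\<forall>t\<in>?I. \<gamma> differentiable (at t)"
    and cont: "continuous_on ?I (\<lambda>t. frechet_derivative \<gamma> (at t) 1)"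
    by auto
  have deriv: "(\<gamma> has_vector_derivative \<gamma>' t) (at t)" if "t \<in> ?I" for t
    using diff that by (simp add: \<gamma>'_def vector_derivative_works)
  have cont': "continuous_on ?I \<gamma>'"
  proof (rule continuous_on_eq[OF cont])
    fix t assume "t \<in> ?I"
    then show "frechet_derivative \<gamma> (at t) 1 = \<gamma>' t"
      using has_derivative_imp_frechet_derivative[OF deriv[unfolded has_vector_derivative_def]] by simp
  qed
  note len = arccos_le_length[OF open_greaterThanLessThan _ _ deriv cont' unit]
  show "path_image \<gamma> \<subseteq> {p \<in> S2. n \<bullet> p < 0}"
  proof
    fix m assume "m \<in> path_image \<gamma>"
    then obtain t where t: "0 \<le> t" "t \<le> 1" and m: "m = \<gamma> t"
      by (auto simp: path_image_def)
    have "arccos (x \<bullet> m) + arccos (m \<bullet> y) \<le>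
        integral {0..t} (\<lambda>t. norm (\<gamma>' t)) + integral {t..1} (\<lambda>t. norm (\<gamma>' t))"
    proof (rule add_mono)
      have "{0..t} \<subseteq> ?I" "{t..1} \<subseteq> ?I" using ab t by auto
      then show "arccos (x \<bullet> m) \<le> integral {0..t} (\<lambda>t. norm (\<gamma>' t))"
        "arccos (m \<bullet> y) \<le> integral {t..1} (\<lambda>t. norm (\<gamma>' t))"
        using t len[of 0 t] len[of t 1] unfolding m ends[symmetric] by blast+
    qed
    also have "\<dots> = integral {0..1} (\<lambda>t. norm (\<gamma>' t))"
      using t ab cont'
      by (intro Henstock_Kurzweil_Integration.integral_combine integrable_continuous_interval continuous_on_norm)
         (auto intro: continuous_on_subset)
    also have "\<dots> = riem_dist round_metric x y"
      unfolding length[symmetric] riem_length_def by (simp add: speed_round[abs_def] \<gamma>'_def)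
    also have "\<dots> \<le> arccos (x \<bullet> y)"
      using x y by (intro riem_dist_round_le_arccos) auto
    finally have "n \<bullet> m < 0"
      using x y unit[of t] t ab by (intro between_points_of_hemisphere[of x y m]) (auto simp: m)
    then show "m \<in> {p \<in> S2. n \<bullet> p < 0}"
      using unit[of t] t ab by (auto simp: m)
  qed
qed auto


section \<open>Isometries and the distance between the poles\<close>

text \<open>
  Every differentiable curve on the sphere is locally the image of a differentiable curve in one of the two
  charts.  This is how smoothness of maps on the sphere, which is expressed in charts, is brought to bear on curves.
\<close>

lemma curve_in_chart:
  fixes c :: "real \<Rightarrow> real^3"
  assumes S2: "\<And>t. c t \<in> S2" and deriv: "(c has_vector_derivative c') (at t)"
  obtains s u u' U where "s\<^sup>2 = 1" "(u has_vector_derivative u') (at t)" "open U" "t \<in> U"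
    "\<And>\<tau>. \<tau> \<in> U \<Longrightarrow> c \<tau> = stereo s (u \<tau>)"
proof -
  obtain s :: real where s: "s\<^sup>2 = 1" "c t $ 3 \<noteq> s"
  proof (cases "c t $ 3 = 1")
    case True
    then show ?thesis by (intro that[of "- 1"]) auto
  next
    case False
    then show ?thesis by (intro that[of 1]) auto
  qed
  have c3: "((\<lambda>\<tau>. c \<tau> $ i) has_vector_derivative c' $ i) (at t)" for i
    by (rule bounded_linear.has_vector_derivative[OF bounded_linear_vec_nth deriv])
  then have isCont: "isCont (\<lambda>\<tau>. c \<tau> $ 3) t"
    using has_vector_derivative_continuous by blast
  then have "\<forall>\<^sub>F \<tau> in nhds t. c \<tau> $ 3 \<noteq> s"
    using tendsto_imp_eventually_ne[OF isCont[unfolded isCont_def] s(2)] s(2)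
    by (simp add: eventually_nhds_conv_at)
  then obtain U where U: "open U" "t \<in> U" "\<And>\<tau>. \<tau> \<in> U \<Longrightarrow> c \<tau> $ 3 \<noteq> s"
    by (auto simp: eventually_nhds)
  have d: "1 - s * c t $ 3 \<noteq> 0" using s by (intro chart_denominator_nonzero)
  have "\<exists>u'. ((\<lambda>\<tau>. stereo_proj s (c \<tau>)) has_vector_derivative u') (at t)"
  proof -
    have "((\<lambda>\<tau>. 1 / (1 - s * c \<tau> $ 3)) has_real_derivative s * c' $ 3 / (1 - s * c t $ 3)\<^sup>2) (at t)"
      using d c3[of 3] unfolding has_real_derivative_iff_has_vector_derivative[symmetric]
      by (auto intro!: derivative_eq_intros simp: power2_eq_square)
    from has_vector_derivative_scaleR[OF this has_vector_derivative_add[OF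
        has_vector_derivative_scaleR[OF c3[of 1, folded has_real_derivative_iff_has_vector_derivative] has_vector_derivative_const]
        has_vector_derivative_scaleR[OF c3[of 2, folded has_real_derivative_iff_has_vector_derivative] has_vector_derivative_const]]]
    show ?thesis unfolding stereo_proj_def by blast
  qed
  then obtain u' where "((\<lambda>\<tau>. stereo_proj s (c \<tau>)) has_vector_derivative u') (at t)" by blast
  with s U show ?thesis
    using stereo_stereo_proj[OF S2 s(1)] by (intro that[of s _ u' U]) auto
qed

lemma smooth_map_curve_differentiable:
  fixes c :: "real \<Rightarrow> real^3" and F :: "real^3 \<Rightarrow> real^3"
  assumes S2: "\<And>t. c t \<in> S2" and deriv: "(c has_vector_derivative c') (at t)"
    and smooth: "\<And>\<phi>. \<phi> \<in> atlas \<Longrightarrow> smooth_on UNIV (F \<circ> \<phi>)"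
  shows "\<exists>v. ((\<lambda>t. F (c t)) has_vector_derivative v) (at t)"
proof -
  obtain s u u' U where s: "s\<^sup>2 = 1" and u: "(u has_vector_derivative u') (at t)"
    and U: "open U" "t \<in> U" "\<And>\<tau>. \<tau> \<in> U \<Longrightarrow> c \<tau> = stereo s (u \<tau>)"
    using curve_in_chart[OF S2 deriv] by blast
  have "smooth_on UNIV (F \<circ> stereo s)"
    using s smooth atlas_eq by blast
  from vector_derivative_diff_chain_within[OF u has_derivative_at_withinI[OF smooth_on_has_derivative[OF this]]]
  have "\<exists>v. ((F \<circ> stereo s \<circ> u) has_vector_derivative v) (at t)" by blast
  then obtain v where "((F \<circ> stereo s \<circ> u) has_vector_derivative v) (at t)" by blast
  then have "((\<lambda>t. F (c t)) has_vector_derivative v) (at t)"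
    by (rule has_vector_derivative_transform_within_open[OF _ U(1,2)]) (simp add: U(3))
  then show ?thesis by blast
qed

text \<open>
  An isometry preserves the speed of curves, here with the speed in the conformal metric written out.  In the
  chart, both sides are the values on the same vector \<open>w'\<close> of the two pulled back forms, which agree by the definition of an
  isometry.
\<close>

lemma isometry_to_round_speed:
  fixes \<gamma> :: "real \<Rightarrow> real^3"
  assumes iso: "isometry (conformal_metric \<Phi>) round_metric f"
    and S2: "\<And>t. \<gamma> t \<in> S2" and \<gamma>': "(\<gamma> has_vector_derivative \<gamma>') (at t)"
    and c': "((\<lambda>t. f (\<gamma> t)) has_vector_derivative c') (at t)"
  shows "norm c' = exp (\<Phi> (\<gamma> t $ 3)) * norm \<gamma>'"
proof -
  obtain s w w' U where s: "s\<^sup>2 = 1" and w: "(w has_vector_derivative w') (at t)"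
    and U: "open U" "t \<in> U" "\<And>\<tau>. \<tau> \<in> U \<Longrightarrow> \<gamma> \<tau> = stereo s (w \<tau>)"
    using curve_in_chart[OF S2 \<gamma>'] by blast
  let ?\<psi> = "stereo s" and ?n = "(w t \<bullet> w t + 1)\<^sup>2"
  have \<psi>: "?\<psi> \<in> atlas" using s atlas_eq by blast
  define D where "D = frechet_derivative (f \<circ> ?\<psi>) (at (w t))"
  have D: "((f \<circ> ?\<psi>) has_derivative D) (at (w t))"
    unfolding D_def using iso \<psi> by (intro smooth_on_has_derivative) (auto simp: isometry_def)
  have "((f \<circ> ?\<psi> \<circ> w) has_vector_derivative D w') (at t)"
    by (rule vector_derivative_diff_chain_within[OF w has_derivative_at_withinI[OF D]])
  then have "((\<lambda>t. f (\<gamma> t)) has_vector_derivative D w') (at t)"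
    by (rule has_vector_derivative_transform_within_open[OF _ U(1,2)]) (simp add: U(3))
  then have c'_eq: "c' = D w'" using c' vector_derivative_unique_at by blast
  have "((?\<psi> \<circ> w) has_vector_derivative stereo_deriv s (w t) w') (at t)"
    by (rule vector_derivative_diff_chain_within[OF w has_derivative_at_withinI[OF stereo_has_derivative]])
  then have "(\<gamma> has_vector_derivative stereo_deriv s (w t) w') (at t)"
    by (rule has_vector_derivative_transform_within_open[OF _ U(1,2)]) (simp add: U(3))
  then have \<gamma>'_eq: "\<gamma>' = stereo_deriv s (w t) w'" using \<gamma>' vector_derivative_unique_at by blast
  have D_axis: "D (axis i 1) \<bullet> D (axis j 1) = of_bool (i = j) * (exp (2 * \<Phi> (\<gamma> t $ 3)) * (4 / ?n))" for i j
  proof -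
    have "D (axis i 1) \<bullet> D (axis j 1) = metric_coeffs round_metric (f \<circ> ?\<psi>) (w t) $ i $ j"
      by (simp add: metric_coeffs_def round_metric_def partial_eq[OF D])
    also have "\<dots> = metric_coeffs (conformal_metric \<Phi>) ?\<psi> (w t) $ i $ j"
      using iso \<psi> by (simp add: isometry_def)
    also have "\<dots> = of_bool (i = j) * (exp (2 * \<Phi> (\<gamma> t $ 3)) * (4 / ?n))"
      unfolding metric_coeffs_conformal[OF s] scalar_matrix_nth by (simp add: U(2,3))
    finally show ?thesis .
  qed
  have lin: "linear D" using D by (rule has_derivative_linear)
  have "w' = w' $ 1 *\<^sub>R axis 1 1 + w' $ 2 *\<^sub>R axis 2 1"
    by (simp add: vec_eq_iff forall_2 axis_def)
  then have "D w' = w' $ 1 *\<^sub>R D (axis 1 1) + w' $ 2 *\<^sub>R D (axis 2 1)"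
    using linear_add[OF lin] linear_scale[OF lin] by metis
  then have "D w' \<bullet> D w' = exp (2 * \<Phi> (\<gamma> t $ 3)) * (4 / ?n) * (w' \<bullet> w')"
  proof -
    have "w' \<bullet> w' = w' $ 1 * w' $ 1 + w' $ 2 * w' $ 2" by (simp add: inner_vec_def sum_2)
    with \<open>D w' = _\<close> show ?thesis by (simp add: inner_add D_axis algebra_simps add_divide_distrib)
  qed
  also have "\<dots> = exp (2 * \<Phi> (\<gamma> t $ 3)) * (\<gamma>' \<bullet> \<gamma>')"
    by (simp add: \<gamma>'_eq stereo_deriv_inner[OF s])
  finally have "(norm c')\<^sup>2 = (exp (\<Phi> (\<gamma> t $ 3)) * norm \<gamma>')\<^sup>2"
    by (simp add: c'_eq power2_norm_eq_inner power_mult_distrib exp_double)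
  then show ?thesis by (simp add: power2_eq_iff_nonneg)
qed

text \<open>
  The function \<open>H\<close> of the height is a calibration: along a curve of unit speed in the conformal metric it changes at
  most at unit rate, so the poles are more than \<open>pi\<close> apart.  The image under the inverse of an isometry of the great circle
  arc that joins the images of the poles would be a curve between the poles of length at most \<open>pi\<close>.
\<close>

lemma not_isometric_of_distant_poles:
  assumes H: "\<And>z. (H has_real_derivative H' z) (at z)"
    and bound: "\<And>z. \<bar>H' z\<bar> \<le> exp (\<Phi> z)"
    and long: "pi < \<bar>H 1 - H (- 1)\<bar>"
  shows "\<not> isometric (conformal_metric \<Phi>) round_metric"
proof
  assume "isometric (conformal_metric \<Phi>) round_metric"
  then obtain f where iso: "isometry (conformal_metric \<Phi>) round_metric f"
    by (auto simp: isometric_def)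
  then have bij: "bij_betw f S2 S2"
    and smooth: "\<And>\<phi>. \<phi> \<in> atlas \<Longrightarrow> smooth_on UNIV (inv_into S2 f \<circ> \<phi>)"
    by (auto simp: isometry_def)
  define south north :: "real^3" where "south = - axis 3 1" and "north = axis 3 1"
  have poles: "south \<in> S2" "north \<in> S2" by (simp_all add: south_def north_def norm_eq_1 inner_axis_axis)
  define x y where "x = f south" and "y = f north"
  have xy: "norm x = 1" "norm y = 1"
    using bij_betw_apply[OF bij poles(1)] bij_betw_apply[OF bij poles(2)] by (simp_all add: x_def y_def)
  define \<theta> where "\<theta> = arccos (x \<bullet> y)"
  have \<theta>: "0 \<le> \<theta>" "\<theta> \<le> pi"
    using unit_inner_range[OF xy] by (simp_all add: \<theta>_def arccos_lbound arccos_ubound)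
  obtain e where e: "norm e = 1" "x \<bullet> e = 0" "y = cos \<theta> *\<^sub>R x + sin \<theta> *\<^sub>R e"
    using great_circle_through[OF _ xy] unfolding \<theta>_def by auto
  define c where "c t = cos t *\<^sub>R x + sin t *\<^sub>R e" for t
  define c' where "c' t = - sin t *\<^sub>R x + cos t *\<^sub>R e" for t
  define \<gamma> where "\<gamma> t = inv_into S2 f (c t)" for t
  have c: "c t \<in> S2" "norm (c' t) = 1" "(c has_vector_derivative c' t) (at t)" for t
    using great_circle_speed[OF xy(1) e(1,2), of t] by (simp_all add: c_def[abs_def] c'_def)
  have \<gamma>_S2: "\<gamma> t \<in> S2" and f_\<gamma>: "f (\<gamma> t) = c t" for t
    using bij c(1)[of t] unfolding \<gamma>_def
    by (metis bij_betw_imp_surj_on inv_into_into, metis bij_betw_inv_into_right)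
  have ends: "\<gamma> 0 = south" "\<gamma> \<theta> = north"
  proof -
    have "c 0 = f south" "c \<theta> = f north" using e(3) by (simp_all add: c_def x_def y_def)
    then show "\<gamma> 0 = south" "\<gamma> \<theta> = north"
      using bij_betw_inv_into_left[OF bij poles(1)] bij_betw_inv_into_left[OF bij poles(2)]
      by (simp_all add: \<gamma>_def)
  qed
  have "\<forall>t. \<exists>v. (\<gamma> has_vector_derivative v) (at t)"
    using smooth_map_curve_differentiable[OF c(1,3) smooth] by (simp add: \<gamma>_def[abs_def])
  then obtain \<gamma>' where \<gamma>': "\<And>t. (\<gamma> has_vector_derivative \<gamma>' t) (at t)" by metis
  have speed: "exp (\<Phi> (\<gamma> t $ 3)) * norm (\<gamma>' t) = 1" for t
    using isometry_to_round_speed[OF iso \<gamma>_S2 \<gamma>', of "c' t" t] c(2,3) by (simp add: f_\<gamma>)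
  have deriv: "((\<lambda>t. H (\<gamma> t $ 3)) has_real_derivative H' (\<gamma> t $ 3) * \<gamma>' t $ 3) (at t)" for t
    by (rule DERIV_chain2[OF H])
       (simp add: has_real_derivative_iff_has_vector_derivative
          bounded_linear.has_vector_derivative[OF bounded_linear_vec_nth \<gamma>'])
  have slope: "norm (H' (\<gamma> t $ 3) * \<gamma>' t $ 3) \<le> 1" for t
  proof -
    have "norm (H' (\<gamma> t $ 3) * \<gamma>' t $ 3) \<le> exp (\<Phi> (\<gamma> t $ 3)) * norm (\<gamma>' t)"
      by (simp add: abs_mult) (intro mult_mono bound component_le_norm_cart, auto)
    then show ?thesis by (simp add: speed)
  qed
  have "norm (H (\<gamma> \<theta> $ 3) - H (\<gamma> 0 $ 3)) \<le> 1 * norm (\<theta> - 0)"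
    by (rule field_differentiable_bound[where S = UNIV, OF _ _ slope]) (auto intro: deriv)
  then have "\<bar>H 1 - H (- 1)\<bar> \<le> \<theta>"
    using \<theta> by (simp add: ends south_def north_def axis_def)
  then show False using long \<theta> by linarith
qed


section \<open>The counterexample to rigidity\<close>

theorem theorem1p3:
  shows "\<exists>(D :: (real^3) set) (g :: metric).
    D \<subset> S2 \<and> s_convex round_metric D \<and>
    riemannian_metric g \<and>
    metrics_agree_on (S2 - D) g round_metric \<and>
    sectional_curvature_le g 1 \<and>
    \<not> isometric g round_metric"
proof (intro exI conjI)
  let ?D = "{p \<in> S2. axis 3 1 \<bullet> p < (0 :: real)}" and ?g = "conformal_metric bump_exponent"
  let ?p1 = "flat_exp_deriv_poly 1"
  have "axis 3 1 \<in> S2 - ?D" by (simp add: norm_eq_1 inner_axis_axis inner_axis_axis)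
  then show "?D \<subset> S2" by blast
  show "s_convex round_metric ?D" by (rule s_convex_open_hemisphere)
  show "riemannian_metric ?g"
  proof (rule riemannian_metric_conformal)
    fix z :: "real^2 \<Rightarrow> real" assume "smooth_on UNIV z"
    then have "smooth_on UNIV (\<lambda>u. 1000 * flat_exp 1 ((-1) * z u))"
      by (intro smooth_on_mult smooth_on_flat_exp smooth_on_const)
    then show "smooth_on UNIV (\<lambda>u. bump_exponent (z u))" by (simp add: bump_exponent_def)
  qed
  show "metrics_agree_on (S2 - ?D) ?g round_metric"
    by (auto simp: metrics_agree_on_def conformal_metric_def round_metric_def bump_exponent_def
        flat_exp_def inner_axis')
  have d: "((\<lambda>z. k * flat_exp p (- z)) has_real_derivative - (k * flat_exp (flat_exp_deriv_poly p) (- z))) (at z)" for k p z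
  proof -
    have "(uminus has_real_derivative - 1) (at z)" by (auto intro!: derivative_eq_intros)
    from DERIV_cmult[OF DERIV_chain2[OF flat_exp_has_derivative[of p] this], of k]
    show ?thesis by simp
  qed
  show "sectional_curvature_le ?g 1"
  proof (rule sectional_curvature_le_conformal)
    show "(bump_exponent has_real_derivative - (1000 * flat_exp ?p1 (- z))) (at z)" for z
      using d[of 1000 1 z] by (simp add: bump_exponent_def[abs_def])
    show "((\<lambda>z. - (1000 * flat_exp ?p1 (- z))) has_real_derivative 1000 * flat_exp (flat_exp_deriv_poly ?p1) (- z)) (at z)" for z
      using d[of "- 1000" ?p1 z] by simp
  qed (use bump_curvature in auto)
  show "\<not> isometric ?g round_metric"
  proof (rule not_isometric_of_distant_poles)
    show "((\<lambda>z. 12 * flat_exp 1 (- z)) has_real_derivative - (12 * flat_exp ?p1 (- z))) (at z)" for z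
      by (rule d)
    show "\<bar>- (12 * flat_exp ?p1 (- z))\<bar> \<le> exp (bump_exponent z)" for z
      using bump_height by simp
    \<comment> \<open>The calibration is \<open>12 * exp (- 1)\<close> at the south pole and \<open>0\<close> at the north pole.\<close>
    have "12 * exp (- 1) \<ge> (4 :: real)"
      using exp_le by (simp add: exp_minus field_simps)
    then show "pi < \<bar>12 * flat_exp 1 (- 1) - 12 * flat_exp 1 (- (- 1))\<bar>"
      using pi_less_4 by (simp add: flat_exp_def)
  qed
qed

end
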